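(* Let $P(x)=x^5+k_2x^3+k_3x^2+k_4x+k_5$ be a real polynomial with $P(x)\neq x^5$. Consider the following three cases: 1) $k_2<0$, $k_3<0$, $k_4=0$ and $k_5=k_2k_3$; 2) $k_2<0$, $k_3<0$, $0<k_4<\frac{k_2^2}{4}$ and $k_5=k_3\left(\frac{k_2}{2}-\sqrt{\frac{k_2^2}{4}-k_4}\right)$; 3) $k_2<0$, $k_3=0$, $k_4=\frac{k_2^2}{4}$ and $k_5=0$. If none of the cases 1), 2), 3) holds, then $P(x)$ is $\mathcal{R}$ if and only if $P(x)$ is $\mathcal{IR}$. If one of the cases 1), 2), 3) holds, then $P(x)$ is not $\mathcal{IR}$.
   Context: A monic real polynomial $P(x)$ of degree $n$ is realizable ($\mathcal{R}$) if it is the characteristic polynomial of some $n\times n$ entrywise nonnegative matrix; it is irreducibly realizable ($\mathcal{IR}$) if it is the characteristic polynomial of some $n\times n$ irreducible entrywise nonnegative matrix. A square matrix is irreducible if it is not similar by a permutation matrix to a nontrivially block triangular matrix (equivalently, its digraph is strongly connected). *)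

theory Defs
  imports "Jordan_Normal_Form.Char_Poly"
begin

definition nonneg_mat :: "real mat \<Rightarrow> bool" where
  "nonneg_mat A \<longleftrightarrow> (\<forall>a \<in> elements_mat A. 0 \<le> a)"

definition perm_mat :: "nat \<Rightarrow> (nat \<Rightarrow> nat) \<Rightarrow> real mat" where
  "perm_mat n p = mat n n (\<lambda>(i, j). if j = p i then 1 else 0)"

definition nontrivially_block_triangular :: "real mat \<Rightarrow> bool" where
  "nontrivially_block_triangular B \<longleftrightarrow>
     (\<exists>r s B1 B2 B4. 0 < r \<and> 0 < s \<and>
        B1 \<in> carrier_mat r r \<and> B2 \<in> carrier_mat r s \<and> B4 \<in> carrier_mat s s \<and>
        B = four_block_mat B1 B2 (0\<^sub>m s r) B4)"

(* For a permutation p the inverse of its permutation matrix is the transpose, so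
   the similarity below reads A = Q B Q^T, i.e. A_ij = B_(p i)(p j).
   With this convention every 1 x 1 matrix, including the zero matrix, is irreducible. *)
definition irreducible_mat :: "real mat \<Rightarrow> bool" where
  "irreducible_mat A \<longleftrightarrow> square_mat A \<and>
     \<not> (\<exists>p B. p permutes {0..<dim_row A} \<and> nontrivially_block_triangular B \<and>
          similar_mat_wit A B (perm_mat (dim_row A) p) (transpose_mat (perm_mat (dim_row A) p)))"

definition realizable :: "real poly \<Rightarrow> bool" where
  "realizable P \<longleftrightarrow>
     (\<exists>A \<in> carrier_mat (degree P) (degree P). nonneg_mat A \<and> char_poly A = P)"

definition irreducibly_realizable :: "real poly \<Rightarrow> bool" where
  "irreducibly_realizable P \<longleftrightarrow>
     (\<exists>A \<in> carrier_mat (degree P) (degree P).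
        nonneg_mat A \<and> irreducible_mat A \<and> char_poly A = P)"

end

theory Submission
  imports Defs
begin

text \<open>
Write the coefficients of the characteristic polynomial of a nonnegative \<open>5 \<times> 5\<close> matrix with zero
diagonal as signed sums over vertex-disjoint cycles of its digraph. The pairs of vertices, joined
when disjoint, form the Petersen graph, which is triangle-free. A weighted Mantel bound for the
weights of the 2-cycles gives \<open>4 k4 \<le> k2\<^sup>2\<close>, and bounds each single weight by
\<open>L = -k2/2 + sqrt (k2\<^sup>2/4 - k4)\<close>; as \<open>k5\<close> is at most the sum over all pairs of the weight of the
2-cycle times that of the 3-cycles on the complement, \<open>k5 \<le> - k3 L\<close>, and trivially
\<open>k5 \<le> k2 k3\<close>, which is the better bound if \<open>k4 \<le> 0\<close>. In the three exceptional cases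
one of these bounds is attained, and the equality analysis kills so many cycles that a proper set
of vertices has no arc leaving it. All other polynomials satisfying the bounds are realized
by explicit strongly connected digraphs.
\<close>

subsection \<open>Characteristic polynomials\<close>

text \<open>Laplace expansion along row 0, for a matrix given by its entry function. Rewriting with
  it repeatedly evaluates a symbolic determinant of concrete size.\<close>

lemma det_mat_Suc:
  fixes f :: "nat \<Rightarrow> nat \<Rightarrow> 'a :: comm_ring_1"
  shows "det (mat (Suc n) (Suc n) (\<lambda>(i, j). f i j)) =
    (\<Sum>j<Suc n. (-1) ^ j * f 0 j *
       det (mat n n (\<lambda>(i, k). f (Suc i) (if k < j then k else Suc k))))"
proof -
  have "mat_delete (mat (Suc n) (Suc n) (\<lambda>(i, j). f i j)) 0 j =
      mat n n (\<lambda>(i, k). f (Suc i) (if k < j then k else Suc k))" if "j < Suc n" for j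
    by (rule eq_matI) (use that in \<open>auto simp: mat_delete_def\<close>)
  then show ?thesis
    by (subst laplace_expansion_row[of _ "Suc n" 0])
      (auto simp: cofactor_def intro!: sum.cong)
qed

lemma poly_char_poly_mat:
  fixes a :: "nat \<Rightarrow> nat \<Rightarrow> 'a :: comm_ring_1"
  shows "poly (char_poly (mat n n (\<lambda>(i, j). a i j))) x =
    det (mat n n (\<lambda>(i, j). (if i = j then x else 0) - a i j))"
  unfolding char_poly_def
  by (rule poly_det_cong[of _ n]) (auto simp: char_poly_matrix_def)

text \<open>Induction on the size: the derivative of the characteristic polynomial is the sum of the
  characteristic polynomials of the principal minors, and deleting index \<open>i\<close> removes
  exactly one diagonal entry from the trace.\<close>

lemma coeff_char_poly_trace:
  fixes A :: "real mat"
  assumes "A \<in> carrier_mat (Suc n) (Suc n)"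
  shows "coeff (char_poly A) n = - (\<Sum>i<Suc n. A $$ (i, i))"
  using assms
proof (induction n arbitrary: A)
  case 0
  then have "poly (char_poly A) 0 = - A $$ (0, 0)"
    by (subst char_poly_matrix[of _ 1]) (auto simp: det_single char_matrix_def)
  then show ?case by (simp add: poly_0_coeff_0)
next
  case (Suc n)
  let ?N = "Suc (Suc n)"
  have diag: "(\<Sum>k<Suc n. mat_delete A i i $$ (k, k)) = (\<Sum>k<?N. A $$ (k, k)) - A $$ (i, i)"
    if i: "i < ?N" for i
  proof -
    have "(\<Sum>k<Suc n. mat_delete A i i $$ (k, k)) =
        (\<Sum>k<Suc n. A $$ (insert_index i k, insert_index i k))"
      using mat_delete_index[OF Suc.prems i i] by (intro sum.cong) auto
    also have "\<dots> = (\<Sum>k\<in>insert_index i ` {..<Suc n}. A $$ (k, k))"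
      by (rule sum.reindex[symmetric, simplified o_def]) (auto simp: inj_on_def insert_index_def split: if_splits)
    also have "insert_index i ` {..<Suc n} = {..<?N} - {i}"
      using insert_index_image[of i "Suc n"] i by (simp add: atLeast0LessThan)
    finally show ?thesis using i by (simp add: sum_diff1)
  qed
  have "real (Suc n) * coeff (char_poly A) (Suc n) = coeff (pderiv (char_poly A)) n"
    by (simp add: coeff_pderiv)
  also have "\<dots> = (\<Sum>i<?N. coeff (char_poly (mat_delete A i i)) n)"
    by (simp add: pderiv_char_poly[OF Suc.prems] coeff_sum)
  also have "\<dots> = (\<Sum>i<?N. A $$ (i, i) - (\<Sum>k<?N. A $$ (k, k)))"
  proof (rule sum.cong[OF refl])
    fix i assume "i \<in> {..<?N}"
    then show "coeff (char_poly (mat_delete A i i)) n = A $$ (i, i) - (\<Sum>k<?N. A $$ (k, k))"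
      using Suc.IH[of "mat_delete A i i"] mat_delete_carrier[OF Suc.prems, of i i] diag[of i] by simp
  qed
  \<comment> \<open>Over the \<open>n + 2\<close> deletions the diagonal entries add up to one
    trace, while a trace is subtracted \<open>n + 2\<close> times.\<close>
  also have "\<dots> = real (Suc n) * - (\<Sum>k<?N. A $$ (k, k))"
    unfolding sum_subtractf by (simp add: algebra_simps)
  finally show ?case by (subst (asm) mult_cancel_left) simp
qed

subsection \<open>Irreducibility as strong connectedness\<close>

text \<open>Row \<open>i\<close> of \<open>perm_mat n p\<close> has its 1 in column
  \<open>p i\<close>, so this matrix is orthogonal and conjugation by it merely relabels
  indices.\<close>

lemma similar_perm_mat_iff:
  assumes p: "p permutes {0..<n}" and A: "A \<in> carrier_mat n n" and B: "B \<in> carrier_mat n n"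
  shows "similar_mat_wit A B (perm_mat n p) (transpose_mat (perm_mat n p)) \<longleftrightarrow>
    (\<forall>i<n. \<forall>j<n. A $$ (i, j) = B $$ (p i, p j))"
proof -
  let ?Q = "perm_mat n p"
  have Q: "?Q \<in> carrier_mat n n" by (simp add: perm_mat_def)
  have p_less: "p i < n" if "i < n" for i
    using permutes_in_image[OF p, of i] that by simp
  have p_eq: "p i = p j \<longleftrightarrow> i = j" for i j
    using permutes_inj[OF p] by (simp add: inj_eq)
  have "?Q * transpose_mat ?Q = 1\<^sub>m n"
    by (rule eq_matI) (auto simp: perm_mat_def scalar_prod_def p_eq p_less if_distrib[of "\<lambda>x. x * _"] cong: if_cong)
  moreover from this have "transpose_mat ?Q * ?Q = 1\<^sub>m n"
    using Q by (intro mat_mult_left_right_inverse[of ?Q n]) auto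
  moreover have "?Q * B * transpose_mat ?Q = mat n n (\<lambda>(i, j). B $$ (p i, p j))"
  proof (rule eq_matI)
    have QB: "?Q * B = mat n n (\<lambda>(i, j). B $$ (p i, j))"
      using B
      by (intro eq_matI)
        (auto simp: perm_mat_def scalar_prod_def p_less if_distrib[of "\<lambda>x. x * _"] cong: if_cong)
    fix i j assume "i < dim_row (mat n n (\<lambda>(i, j). B $$ (p i, p j)))"
      "j < dim_col (mat n n (\<lambda>(i, j). B $$ (p i, p j)))"
    then show "(?Q * B * transpose_mat ?Q) $$ (i, j) = mat n n (\<lambda>(i, j). B $$ (p i, p j)) $$ (i, j)"
      unfolding QB
      by (simp add: perm_mat_def scalar_prod_def p_less if_distrib[of "\<lambda>x. _ * x"] cong: if_cong)
  qed (use Q in auto)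
  moreover have "A = mat n n (\<lambda>(i, j). B $$ (p i, p j)) \<longleftrightarrow>
      (\<forall>i<n. \<forall>j<n. A $$ (i, j) = B $$ (p i, p j))"
    using A by (auto simp: mat_eq_iff)
  ultimately show ?thesis
    using A B Q by (auto simp: similar_mat_wit_def Let_def)
qed

lemma irreducible_mat_iff_permuted:
  assumes A: "A \<in> carrier_mat n n"
  shows "irreducible_mat A \<longleftrightarrow>
    (\<forall>p B. p permutes {0..<n} \<longrightarrow> B \<in> carrier_mat n n \<longrightarrow>
      (\<forall>i<n. \<forall>j<n. A $$ (i, j) = B $$ (p i, p j)) \<longrightarrow> \<not> nontrivially_block_triangular B)"
proof -
  have dims: "dim_row A = n" "square_mat A" using A by auto
  have carrier: "B \<in> carrier_mat n n" if "similar_mat_wit A B P Q" for B P Q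
    using that dims by (simp add: similar_mat_wit_def Let_def)
  have "similar_mat_wit A B (perm_mat n p) (transpose_mat (perm_mat n p)) \<longleftrightarrow>
      B \<in> carrier_mat n n \<and> (\<forall>i<n. \<forall>j<n. A $$ (i, j) = B $$ (p i, p j))"
    if "p permutes {0..<n}" for p B
    using similar_perm_mat_iff[OF that A] carrier by blast
  then show ?thesis
    unfolding irreducible_mat_def dims(1) using dims(2) by blast
qed

text \<open>A lower left zero block after relabelling is the same as a proper nonempty set
  \<open>X\<close> of vertices without outgoing arcs: \<open>X\<close> consists of the indices sent
  to the rows of that block.\<close>

lemma irreducible_mat_iff:
  assumes A: "A \<in> carrier_mat n n"
  shows "irreducible_mat A \<longleftrightarrow>
    (\<forall>X \<subseteq> {0..<n}. X \<noteq> {} \<longrightarrow> X \<noteq> {0..<n} \<longrightarrow> (\<exists>i\<in>X. \<exists>j\<in>{0..<n} - X. A $$ (i, j) \<noteq> 0))"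
    (is "_ \<longleftrightarrow> ?connected")
proof
  show ?connected if irred: "irreducible_mat A"
  proof (intro allI impI, rule ccontr)
    fix X assume X: "X \<subseteq> {0..<n}" "X \<noteq> {}" "X \<noteq> {0..<n}"
      and closed: "\<not> (\<exists>i\<in>X. \<exists>j\<in>{0..<n} - X. A $$ (i, j) \<noteq> 0)"
    let ?Y = "{0..<n} - X"
    have fin: "finite X" using X(1) finite_subset by blast
    define s r where "s = card X" and "r = card ?Y"
    have "r + s = n"
      using card_Diff_subset[OF fin X(1)] card_mono[OF _ X(1)] by (simp add: r_def s_def)
    have "0 < s" using X(2) fin by (auto simp: s_def card_gt_0_iff)
    have "0 < r" using X by (auto simp: r_def card_gt_0_iff)
    obtain g where g: "bij_betw g ?Y {0..<r}"
      using ex_bij_betw_finite_nat[of ?Y] by (auto simp: r_def)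
    have "card {r..<n} = card X" using \<open>r + s = n\<close> by (auto simp: s_def)
    then obtain h where h: "bij_betw h X {r..<n}"
      using finite_same_card_bij[OF fin, of "{r..<n}"] by auto
    \<comment> \<open>The relabelling moves \<open>X\<close> to the last \<open>s\<close> positions
      and its complement to the first \<open>r\<close>.\<close>
    define p where "p i = (if i \<in> X then h i else if i < n then g i else i)" for i
    have "bij_betw p X {r..<n}" using h by (rule bij_betw_cong[THEN iffD1, rotated]) (simp add: p_def)
    moreover have "bij_betw p ?Y {0..<r}"
      using g by (rule bij_betw_cong[THEN iffD1, rotated]) (auto simp: p_def)
    ultimately have "bij_betw p (X \<union> ?Y) ({r..<n} \<union> {0..<r})"
      by (rule bij_betw_combine) auto
    moreover have "X \<union> ?Y = {0..<n}" "{r..<n} \<union> {0..<r} = {0..<n}"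
      using X(1) \<open>r + s = n\<close> by auto
    ultimately have p: "p permutes {0..<n}"
      using X(1) by (intro bij_imp_permutes) (auto simp: p_def)
    have inX: "i \<in> X \<longleftrightarrow> r \<le> p i" if "i < n" for i
    proof (cases "i \<in> X")
      case True
      then show ?thesis using bij_betwE[OF \<open>bij_betw p X {r..<n}\<close>] by simp
    next
      case False
      then have "p i \<in> {0..<r}" using bij_betwE[OF \<open>bij_betw p ?Y {0..<r}\<close>] that by auto
      then show ?thesis using False by simp
    qed
    define q where "q = inv_into UNIV p"
    have q_less: "q i < n" if "i < n" for i
      using permutes_in_image[OF permutes_inv[OF p], of i] that by (simp add: q_def)
    have pq: "p (q i) = i" "q (p i) = i" for i
      using permutes_inverses[OF p] by (simp_all add: q_def)
    define b where "b = (\<lambda>i j. A $$ (q i, q j))"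
    define B where "B = mat n n (\<lambda>(i, j). b i j)"
    have zero: "b i j = 0" if "r \<le> i" "i < n" "j < r" for i j
    proof -
      have "q i \<in> X" "q j \<notin> X" "q j < n"
        using inX[of "q i"] inX[of "q j"] q_less[of i] q_less[of j] pq that \<open>r + s = n\<close> by auto
      then show ?thesis using closed by (auto simp: b_def)
    qed
    define B1 B2 B4 where "B1 = mat r r (\<lambda>(i, j). b i j)"
      and "B2 = mat r s (\<lambda>(i, j). b i (r + j))" and "B4 = mat s s (\<lambda>(i, j). b (r + i) (r + j))"
    have carriers: "B1 \<in> carrier_mat r r" "B2 \<in> carrier_mat r s" "B4 \<in> carrier_mat s s"
      by (simp_all add: B1_def B2_def B4_def)
    have "B = four_block_mat B1 B2 (0\<^sub>m s r) B4"
      using \<open>r + s = n\<close> by (intro eq_matI) (auto simp: B_def B1_def B2_def B4_def zero)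
    then have "nontrivially_block_triangular B"
      unfolding nontrivially_block_triangular_def using \<open>0 < s\<close> \<open>0 < r\<close> carriers by blast
    moreover have "B \<in> carrier_mat n n" by (simp add: B_def)
    moreover have "\<forall>i<n. \<forall>j<n. A $$ (i, j) = B $$ (p i, p j)"
      using permutes_in_image[OF p] by (simp add: B_def b_def pq)
    ultimately show False
      using irred[unfolded irreducible_mat_iff_permuted[OF A], rule_format, of p B] p by simp
  qed
  show "irreducible_mat A" if conn: ?connected
    unfolding irreducible_mat_iff_permuted[OF A]
  proof (intro allI impI notI)
    fix p B
    assume p: "p permutes {0..<n}" and Bc: "B \<in> carrier_mat n n"
      and A_eq: "\<forall>i<n. \<forall>j<n. A $$ (i, j) = B $$ (p i, p j)"
      and B: "nontrivially_block_triangular B"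
    obtain r s B1 B2 B4 where rs: "0 < r" "0 < s"
      and blocks: "B1 \<in> carrier_mat r r" "B2 \<in> carrier_mat r s" "B4 \<in> carrier_mat s s"
      and B_eq: "B = four_block_mat B1 B2 (0\<^sub>m s r) B4"
      using B unfolding nontrivially_block_triangular_def by blast
    have "dim_row B = r + s" unfolding B_eq using carrier_matD[OF blocks(1)] carrier_matD[OF blocks(3)] by simp
    then have n: "n = r + s" using carrier_matD(1)[OF Bc] by simp
    have surj: "\<exists>i<n. p i = k" if "k < n" for k
    proof -
      have "k \<in> p ` {0..<n}" unfolding permutes_image[OF p] using that by simp
      then show ?thesis by auto
    qed
    have p_less: "p i < n" if "i < n" for i
      using permutes_in_image[OF p, of i] that by simp
    \<comment> \<open>These are the indices whose new position is a row of the zero block.\<close>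
    let ?X = "{i \<in> {0..<n}. r \<le> p i}"
    obtain k where k: "k < n" "p k = r" using surj[of r] rs n by auto
    obtain l where l: "l < n" "p l = 0" using surj[of 0] rs n by auto
    have "k \<in> ?X" "l \<notin> ?X" "l \<in> {0..<n}" using k l rs by simp_all
    then have "?X \<noteq> {}" "?X \<noteq> {0..<n}" by blast+
    then obtain i j where "i \<in> ?X" "j \<in> {0..<n} - ?X" "A $$ (i, j) \<noteq> 0"
      using conn[rule_format, of ?X] by blast
    then have "r \<le> p i" "p i < n" "p j < r" "i < n" "j < n" "A $$ (i, j) \<noteq> 0"
      using p_less[of i] by auto
    moreover have "B $$ (p i, p j) = 0"
      using blocks n \<open>r \<le> p i\<close> \<open>p i < n\<close> \<open>p j < r\<close> unfolding B_eq by simp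
    ultimately show False
      using A_eq by simp
  qed
qed

section \<open>Simple paths and closed walks in the digraph of a matrix\<close>

text \<open>The path is extended at its front; if the new vertex already occurs on it, the part
  before that occurrence is cut off.\<close>

lemma rtrancl_imp_distinct_path:
  assumes "(v, u) \<in> R\<^sup>*"
  shows "\<exists>xs. distinct (v # xs) \<and> last (v # xs) = u \<and> successively (\<lambda>x y. (x, y) \<in> R) (v # xs)"
  using assms
proof (induction rule: converse_rtrancl_induct)
  case base
  show ?case by (rule exI[of _ "[]"]) simp
next
  case (step v y)
  then obtain xs where xs: "distinct (y # xs)" "last (y # xs) = u"
    "successively (\<lambda>x y. (x, y) \<in> R) (y # xs)" by blast
  show ?case
  proof (cases "v \<in> set (y # xs)")
    case True
    then obtain ys zs where "y # xs = ys @ v # zs" by (meson split_list)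
    with xs show ?thesis
      by (intro exI[of _ zs]) (auto simp: successively_append_iff)
  next
    case False
    with xs step.hyps(1) show ?thesis
      by (intro exI[of _ "y # xs"]) auto
  qed
qed

text \<open>The set of vertices reachable from \<open>v\<close> has no outgoing arc, so it must be
  everything.\<close>

lemma irreducible_mat_reachable:
  assumes A: "A \<in> carrier_mat n n" and irred: "irreducible_mat A" and "u < n" "v < n"
  shows "(v, u) \<in> {(i, j). i < n \<and> j < n \<and> A $$ (i, j) \<noteq> 0}\<^sup>*" (is "_ \<in> ?R\<^sup>*")
proof (rule ccontr)
  assume not_reachable: "(v, u) \<notin> ?R\<^sup>*"
  let ?X = "{x \<in> {0..<n}. (v, x) \<in> ?R\<^sup>*}"
  have "v \<in> ?X" "u \<notin> ?X" "u \<in> {0..<n}" using not_reachable \<open>u < n\<close> \<open>v < n\<close> by auto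
  then have "?X \<noteq> {}" "?X \<noteq> {0..<n}" by blast+
  then obtain i j where ij: "i \<in> ?X" "j \<in> {0..<n} - ?X" "A $$ (i, j) \<noteq> 0"
    using irred[unfolded irreducible_mat_iff[OF A], rule_format, of ?X] by blast
  then have "(i, j) \<in> ?R" by auto
  with ij(1) have "(v, j) \<in> ?R\<^sup>*" by (auto intro: rtrancl_into_rtrancl)
  with ij(2) show False by auto
qed

text \<open>A walk that enters a set without outgoing arcs stays there. As it returns to its start,
  all of it lies in the set. The explicit matrices below are shown irreducible in this way.\<close>

lemma irreducible_mat_if_closed_walk:
  assumes A: "A \<in> carrier_mat n n"
    and walk: "successively (\<lambda>i j. A $$ (i, j) \<noteq> 0) ws" "last ws = hd ws" "set ws = {0..<n}"
  shows "irreducible_mat A"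
  unfolding irreducible_mat_iff[OF A]
proof (intro allI impI, rule ccontr)
  fix X assume X: "X \<subseteq> {0..<n}" "X \<noteq> {}" "X \<noteq> {0..<n}"
    and "\<not> (\<exists>i\<in>X. \<exists>j\<in>{0..<n} - X. A $$ (i, j) \<noteq> 0)"
  then have closed: "j \<in> X" if "i \<in> X" "j < n" "A $$ (i, j) \<noteq> 0" for i j
    using that by auto
  have stay: "set (x # xs) \<subseteq> X"
    if "successively (\<lambda>i j. A $$ (i, j) \<noteq> 0) (x # xs)" "x \<in> X" "set xs \<subseteq> {0..<n}" for x xs
    using that
  proof (induction xs arbitrary: x)
    case (Cons y ys)
    then have "y \<in> X" using closed[of x y] by simp
    with Cons.IH[of y] Cons.prems show ?case by simp
  qed simp
  obtain x where "x \<in> X" using X(2) by blast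
  then have "x \<in> set ws" using X(1) walk(3) by blast
  then obtain us vs where ws: "ws = us @ x # vs" by (meson split_list)
  have "set (x # vs) \<subseteq> X"
    using walk(1,3) \<open>x \<in> X\<close> unfolding ws by (intro stay) (auto simp: successively_append_iff)
  moreover have "last ws \<in> set (x # vs)" by (simp add: ws)
  ultimately have "hd ws \<in> X" using walk(2) by auto
  moreover obtain y ys where yys: "ws = y # ys" using \<open>x \<in> set ws\<close> by (cases ws) auto
  ultimately have "set (y # ys) \<subseteq> X"
    using walk(1,3) by (intro stay) auto
  then show False using X walk(3) yys by blast
qed

subsection \<open>Weighted triangle-free graphs\<close>

locale weighted_triangle_free_graph =
  fixes V :: "'v set" and adj :: "'v \<Rightarrow> 'v \<Rightarrow> bool" and w :: "'v \<Rightarrow> real"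
  assumes finite_V: "finite V"
    and adj_sym: "adj e f \<Longrightarrow> adj f e"
    and triangle_free: "\<lbrakk>e \<in> V; f \<in> V; g \<in> V; adj e f; adj e g\<rbrakk> \<Longrightarrow> \<not> adj f g"
    and w_nonneg: "e \<in> V \<Longrightarrow> 0 \<le> w e"
begin

definition nbrs :: "'v \<Rightarrow> 'v set" where
  "nbrs e = {f \<in> V. adj e f}"

definition wdeg :: "'v \<Rightarrow> real" where
  "wdeg e = sum w (nbrs e)"

lemma finite_nbrs: "finite (nbrs e)"
  using finite_V by (simp add: nbrs_def)

lemma nbrs_subset: "nbrs e \<subseteq> V"
  by (auto simp: nbrs_def)

lemma not_adj_self: "e \<in> V \<Longrightarrow> \<not> adj e e"
  using triangle_free by blast

text \<open>The sum runs over ordered pairs, so \<open>edge_sum V V\<close> counts every edge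
  twice.\<close>

definition edge_sum :: "'v set \<Rightarrow> 'v set \<Rightarrow> real" where
  "edge_sum X Y = (\<Sum>g\<in>X. \<Sum>h\<in>Y. if adj g h then w g * w h else 0)"

lemma edge_sum_commute: "edge_sum X Y = edge_sum Y X"
proof -
  have "edge_sum X Y = (\<Sum>h\<in>Y. \<Sum>g\<in>X. if adj g h then w g * w h else 0)"
    unfolding edge_sum_def by (rule sum.swap)
  also have "\<dots> = edge_sum Y X"
    unfolding edge_sum_def using adj_sym by (intro sum.cong refl) (auto simp: mult.commute)
  finally show ?thesis .
qed

lemma edge_sum_V: "edge_sum X V = (\<Sum>g\<in>X. w g * wdeg g)"
  unfolding edge_sum_def wdeg_def nbrs_def sum_distrib_left
  by (intro sum.cong refl sum.inter_filter[symmetric] finite_V)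

lemma edge_sum_split:
  assumes "X \<subseteq> V"
  shows "edge_sum Z V = edge_sum Z X + edge_sum Z (V - X)"
  unfolding edge_sum_def sum.distrib[symmetric]
  using sum.subset_diff[OF assms finite_V] by (intro sum.cong refl) (simp add: add.commute)

lemma edge_sum_nonneg: "X \<subseteq> V \<Longrightarrow> Y \<subseteq> V \<Longrightarrow> 0 \<le> edge_sum X Y"
  unfolding edge_sum_def by (intro sum_nonneg) (auto intro!: mult_nonneg_nonneg w_nonneg)

text \<open>Every edge has an endpoint outside the independent set \<open>nbrs e\<close>;
  the edges with both endpoints outside are counted twice.\<close>

lemma edge_sum_eq:
  assumes "e \<in> V"
  defines "U \<equiv> V - nbrs e"
  shows "edge_sum V V = 2 * (\<Sum>g\<in>U. w g * wdeg g) - edge_sum U U"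
proof -
  let ?N = "nbrs e"
  have "edge_sum ?N ?N = 0"
    unfolding edge_sum_def using triangle_free assms(1) by (intro sum.neutral ballI) (auto simp: nbrs_def)
  moreover have "edge_sum V V = edge_sum V ?N + edge_sum V U"
    unfolding U_def by (rule edge_sum_split[OF nbrs_subset])
  moreover have "edge_sum ?N V = edge_sum ?N ?N + edge_sum ?N U"
    unfolding U_def by (rule edge_sum_split[OF nbrs_subset])
  moreover have "edge_sum U V = edge_sum U ?N + edge_sum U U"
    unfolding U_def by (rule edge_sum_split[OF nbrs_subset])
  ultimately have "edge_sum V V = 2 * edge_sum U V - edge_sum U U"
    using edge_sum_commute[of V ?N] edge_sum_commute[of ?N U] edge_sum_commute[of V U] by linarith
  then show ?thesis by (simp add: edge_sum_V)
qed

text \<open>In \<open>edge_sum_eq\<close> the vertex \<open>e\<close> contributes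
  \<open>w e * wdeg e\<close>, and any other non-neighbour \<open>g\<close> has weighted degree at
  most \<open>sum w V - w e\<close>, since \<open>e\<close> is not adjacent to it. The term with
  \<open>R\<close> is kept for the equality case, where \<open>w e\<close> exceeds half the total
  weight.\<close>

lemma edge_sum_le_vertex:
  assumes e: "e \<in> V" and R: "R = V - nbrs e - {e}"
  shows "edge_sum V V \<le> 2 * w e * (sum w V - w e) - 2 * sum w R * (2 * w e - sum w V)"
proof -
  have eU: "e \<in> V - nbrs e" using e not_adj_self by (auto simp: nbrs_def)
  have fin: "finite (V - nbrs e)" using finite_V by simp
  have nonadj: "wdeg g \<le> sum w V - w e" if "g \<in> R" for g
  proof -
    have "sum w (nbrs g) \<le> sum w (V - {e})"
      using that R adj_sym w_nonneg finite_V by (intro sum_mono2) (auto simp: nbrs_def)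
    then show ?thesis using e finite_V by (simp add: wdeg_def sum_diff1)
  qed
  have R': "R = (V - nbrs e) - {e}" by (simp add: R)
  have "sum w V = sum w (nbrs e) + sum w (V - nbrs e)"
    using sum.subset_diff[OF nbrs_subset[of e] finite_V, of w] by simp
  also have "sum w (V - nbrs e) = w e + sum w R"
    unfolding R' by (rule sum.remove[OF fin eU])
  finally have S: "sum w V = wdeg e + w e + sum w R" by (simp add: wdeg_def)
  have "(\<Sum>g\<in>R. w g * wdeg g) \<le> (\<Sum>g\<in>R. w g * (sum w V - w e))"
    using R by (intro sum_mono mult_left_mono nonadj w_nonneg) auto
  then have "(\<Sum>g\<in>V - nbrs e. w g * wdeg g) \<le> w e * wdeg e + sum w R * (sum w V - w e)"
    unfolding sum.remove[OF fin eU] R'[symmetric] by (simp add: sum_distrib_right)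
  moreover have "edge_sum V V \<le> 2 * (\<Sum>g\<in>V - nbrs e. w g * wdeg g)"
    using edge_sum_eq[OF e] edge_sum_nonneg[of "V - nbrs e" "V - nbrs e"] by simp
  ultimately have "edge_sum V V \<le> 2 * (w e * wdeg e + sum w R * (sum w V - w e))" by argo
  also have "wdeg e = sum w V - w e - sum w R" using S by simp
  finally show ?thesis by (simp add: algebra_simps)
qed

text \<open>Weighted Mantel theorem. With \<open>e\<close> of maximal weighted degree
  \<open>d\<close>, the deficit is a sum of three nonnegative terms, all of which vanish in the
  extremal case; the neighbours of \<open>e\<close> then form one side \<open>N\<close> of a
  complete bipartite graph on the vertices of positive weight.\<close>

lemma
  shows edge_sum_le: "2 * edge_sum V V \<le> (sum w V)\<^sup>2"
    and edge_sum_extremal: "2 * edge_sum V V = (sum w V)\<^sup>2 \<Longrightarrow>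
      \<exists>N \<subseteq> V. 2 * sum w N = sum w V \<and> (\<forall>g\<in>V - N. \<forall>h\<in>N. 0 < w g \<longrightarrow> 0 < w h \<longrightarrow> adj g h)"
proof -
  have "2 * edge_sum V V \<le> (sum w V)\<^sup>2 \<and> (2 * edge_sum V V = (sum w V)\<^sup>2 \<longrightarrow>
      (\<exists>N \<subseteq> V. 2 * sum w N = sum w V \<and> (\<forall>g\<in>V - N. \<forall>h\<in>N. 0 < w g \<longrightarrow> 0 < w h \<longrightarrow> adj g h)))"
  proof (cases "V = {}")
    case True
    then show ?thesis by (simp add: edge_sum_def)
  next
    case False
    then obtain e where e: "e \<in> V" and max: "\<And>g. g \<in> V \<Longrightarrow> wdeg g \<le> wdeg e"
      using finite_V Max_in[of "wdeg ` V"] Max_ge[of "wdeg ` V"] by fastforce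
    define U where "U = V - nbrs e"
    have UV: "U \<subseteq> V" by (auto simp: U_def)
    have finU: "finite U" using finite_V by (simp add: U_def)
    let ?S = "sum w V" and ?d = "wdeg e"
    have sumU: "sum w U = ?S - ?d"
      using sum_diff[OF finite_V nbrs_subset, of w e] by (simp add: U_def wdeg_def)
    have slack_nonneg: "0 \<le> w g * (?d - wdeg g)" if "g \<in> U" for g
      using that UV max w_nonneg by (intro mult_nonneg_nonneg) auto
    have "(\<Sum>g\<in>U. w g * wdeg g) = (?S - ?d) * ?d - (\<Sum>g\<in>U. w g * (?d - wdeg g))"
      unfolding sumU[symmetric] by (simp add: sum_distrib_right sum_subtractf algebra_simps)
    \<comment> \<open>The three subtracted terms measure how far \<open>d\<close> is from half the
      weight, how far the degrees in \<open>U\<close> fall below \<open>d\<close>, and how many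
      edges run inside \<open>U\<close>.\<close>
    then have eq: "2 * edge_sum V V = ?S\<^sup>2 - (?S - 2 * ?d)\<^sup>2
        - 4 * (\<Sum>g\<in>U. w g * (?d - wdeg g)) - 2 * edge_sum U U"
      using edge_sum_eq[OF e, folded U_def] by (simp add: power2_eq_square algebra_simps)
    have slack: "0 \<le> (\<Sum>g\<in>U. w g * (?d - wdeg g))" using slack_nonneg by (rule sum_nonneg)
    have UU: "0 \<le> edge_sum U U" using UV by (simp add: edge_sum_nonneg)
    show ?thesis
    proof (intro conjI impI)
      show "2 * edge_sum V V \<le> ?S\<^sup>2" using eq slack UU by (smt (verit) zero_le_power2)
    next
      assume extremal: "2 * edge_sum V V = ?S\<^sup>2"
      have "(?S - 2 * ?d)\<^sup>2 = 0" "(\<Sum>g\<in>U. w g * (?d - wdeg g)) = 0" "edge_sum U U = 0"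
        using eq extremal slack UU by (smt (verit) zero_le_power2)+
      then have d: "2 * ?d = ?S" and tight: "\<And>g. g \<in> U \<Longrightarrow> w g * (?d - wdeg g) = 0"
        using sum_nonneg_eq_0_iff[OF finU slack_nonneg] by auto
      have indep: "w g * w h = 0" if "g \<in> U" "h \<in> U" "adj g h" for g h
      proof -
        have "(if adj g h then w g * w h else 0) \<le> (\<Sum>h\<in>U. if adj g h then w g * w h else 0)"
          using that UV finU by (intro member_le_sum) (auto intro!: mult_nonneg_nonneg w_nonneg)
        also have "\<dots> \<le> edge_sum U U"
          unfolding edge_sum_def
          using that UV finU
          by (intro member_le_sum[where f = "\<lambda>g. \<Sum>h\<in>U. if adj g h then w g * w h else 0"] sum_nonneg)
            (auto intro!: mult_nonneg_nonneg w_nonneg)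
        finally show ?thesis
          using that UV \<open>edge_sum U U = 0\<close> w_nonneg[of g] w_nonneg[of h]
          by (smt (verit) mult_nonneg_nonneg subsetD)
      qed
      have "adj g h" if g: "g \<in> V - nbrs e" and h: "h \<in> nbrs e" and pos: "0 < w g" "0 < w h" for g h
      proof (rule ccontr)
        assume "\<not> adj g h"
        \<comment> \<open>As \<open>U\<close> spans no edge of positive weight, the degree of
          \<open>g\<close> comes from \<open>nbrs e\<close> alone. Missing \<open>h\<close> would
          make it smaller than \<open>wdeg e\<close>, against \<open>tight\<close>.\<close>
        have "wdeg g = sum w (nbrs g \<inter> nbrs e)"
          unfolding wdeg_def
        proof (rule sum.mono_neutral_right[OF finite_nbrs])
          show "\<forall>f\<in>nbrs g - nbrs g \<inter> nbrs e. w f = 0"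
            using indep[of g] g pos by (auto simp: U_def nbrs_def)
        qed auto
        also have "\<dots> \<le> sum w (nbrs e - {h})"
          using \<open>\<not> adj g h\<close> finite_nbrs nbrs_subset w_nonneg
          by (intro sum_mono2) (auto simp: nbrs_def)
        also have "\<dots> = ?d - w h"
          using h finite_nbrs by (simp add: wdeg_def sum_diff1)
        finally show False using tight[of g] g pos by (auto simp: U_def)
      qed
      then show "\<exists>N \<subseteq> V. 2 * sum w N = ?S \<and>
          (\<forall>g\<in>V - N. \<forall>h\<in>N. 0 < w g \<longrightarrow> 0 < w h \<longrightarrow> adj g h)"
        using d nbrs_subset by (intro exI[of _ "nbrs e"]) (auto simp: wdeg_def)
    qed
  qed
  then show "2 * edge_sum V V \<le> (sum w V)\<^sup>2"
    and "2 * edge_sum V V = (sum w V)\<^sup>2 \<Longrightarrow>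
      \<exists>N \<subseteq> V. 2 * sum w N = sum w V \<and> (\<forall>g\<in>V - N. \<forall>h\<in>N. 0 < w g \<longrightarrow> 0 < w h \<longrightarrow> adj g h)"
    by auto
qed

end

subsection \<open>Coefficients of the characteristic polynomial as cycle sums\<close>

definition disjoint_pairs :: "nat \<times> nat \<Rightarrow> nat \<times> nat \<Rightarrow> bool" where
  "disjoint_pairs e f \<longleftrightarrow> {fst e, snd e} \<inter> {fst f, snd f} = {}"

text \<open>Each two-element set of vertices is represented once, in increasing order.\<close>

definition pairs5 :: "(nat \<times> nat) set" where
  "pairs5 = {(i, j). i < j \<and> j < 5}"

context
  fixes a :: "nat \<Rightarrow> nat \<Rightarrow> real"
begin

definition two_cycle :: "nat \<times> nat \<Rightarrow> real" where
  "two_cycle e = a (fst e) (snd e) * a (snd e) (fst e)"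

text \<open>A cycle is counted once for each of its starting points, hence the divisors. In
  \<open>co_three_cycles\<close> the terms with repeated vertices vanish when \<open>a\<close> has zero diagonal.\<close>

definition co_three_cycles :: "nat \<times> nat \<Rightarrow> real" where
  "co_three_cycles e =
     (\<Sum>x\<in>{..<5} - {fst e, snd e}. \<Sum>y\<in>{..<5} - {fst e, snd e}. \<Sum>z\<in>{..<5} - {fst e, snd e}.
        a x y * a y z * a z x) / 3"

definition four_cycles :: real where
  "four_cycles = (\<Sum>x<5. \<Sum>y\<in>{..<5} - {x}. \<Sum>z\<in>{..<5} - {x, y}. \<Sum>u\<in>{..<5} - {x, y, z}.
     a x y * a y z * a z u * a u x) / 4"

definition five_cycles :: real where
  "five_cycles = (\<Sum>x<5. \<Sum>y\<in>{..<5} - {x}. \<Sum>z\<in>{..<5} - {x, y}. \<Sum>u\<in>{..<5} - {x, y, z}.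
     \<Sum>v\<in>{..<5} - {x, y, z, u}. a x y * a y z * a z u * a u v * a v x) / 5"

end

lemma lessThan5: "{..<5::nat} = {0,1,2,3,4}"
  by (auto simp: eval_nat_numeral lessThan_Suc)

text \<open>As a congruence rule this keeps the simplifier from rewriting a summand before the range of
  summation has been enumerated, which would blow up the nested sums.\<close>

lemma sum_weak_cong: "A = B \<Longrightarrow> sum f A = sum f B" by simp

lemma mat_5_Suc: "mat 5 5 f = mat (Suc (Suc (Suc (Suc (Suc 0))))) (Suc (Suc (Suc (Suc (Suc 0))))) f"
  by (simp add: eval_nat_numeral)

lemma pairs5_eq:
  "pairs5 = {(0,1),(0,2),(0,3),(0,4),(1,2),(1,3),(1,4),(2,3),(2,4),(3,4)}"
proof (intro equalityI subsetI)
  fix e assume "e \<in> pairs5"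
  then obtain i j where e: "e = (i, j)" "i < j" "j < 5" by (auto simp: pairs5_def)
  from e(2,3) have "j = 1 \<or> j = 2 \<or> j = 3 \<or> j = 4" by arith
  with e(2) consider "j = 1" "i < 1" | "j = 2" "i < 2" | "j = 3" "i < 3" | "j = 4" "i < 4"
    by fastforce
  then show "e \<in> {(0,1),(0,2),(0,3),(0,4),(1,2),(1,3),(1,4),(2,3),(2,4),(3,4)}"
    by cases (auto simp: e(1) less_Suc_eq numeral_eq_Suc)
qed (auto simp: pairs5_def)

text \<open>In the Leibniz expansion a family of disjoint cycles on \<open>k\<close> vertices
  contributes its weight to the coefficient of \<open>x ^ (5 - k)\<close>, with sign -1 for each
  cycle. Four vertices carry a 4-cycle or two 2-cycles, five a 5-cycle or a 2-cycle and a 3-cycle.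
  The double sum meets each unordered pair of 2-cycles twice, hence the division by 2.\<close>

lemma poly_char_poly_mat5:
  fixes a :: "nat \<Rightarrow> nat \<Rightarrow> real"
  assumes "\<And>i. i < 5 \<Longrightarrow> a i i = 0"
  shows "poly (char_poly (mat 5 5 (\<lambda>(i, j). a i j))) x =
     x ^ 5 - (\<Sum>e\<in>pairs5. two_cycle a e) * x ^ 3 - (\<Sum>e\<in>pairs5. co_three_cycles a e) * x ^ 2
     + ((\<Sum>e\<in>pairs5. \<Sum>f\<in>pairs5. if disjoint_pairs e f then two_cycle a e * two_cycle a f else 0) / 2
        - four_cycles a) * x
     + ((\<Sum>e\<in>pairs5. two_cycle a e * co_three_cycles a e) - five_cycles a)"
proof -
  have diag: "a 0 0 = 0" "a (Suc 0) (Suc 0) = 0" "a 2 2 = 0" "a 3 3 = 0" "a 4 4 = 0"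
    using assms by auto
  have numerals: "Suc (Suc 0) = 2" "Suc (Suc (Suc 0)) = 3" "Suc (Suc (Suc (Suc 0))) = 4"
    by auto
  show ?thesis
    unfolding poly_char_poly_mat mat_5_Suc
    by (simp add: det_mat_Suc cong: sum_weak_cong, simp add: numerals,
        simp add: diag four_cycles_def five_cycles_def two_cycle_def co_three_cycles_def lessThan5
          insert_Diff_if pairs5_eq disjoint_pairs_def cong: sum_weak_cong,
        simp add: algebra_simps power2_eq_square power3_eq_cube add_divide_distrib
          power_numeral_even power_numeral_odd)
qed

text \<open>The vanishing coefficient of degree 4 is minus the trace, and nonnegative diagonal
  entries with sum 0 all vanish. This makes the cycle formula applicable.\<close>

lemma coeffs_char_poly5:
  fixes a :: "nat \<Rightarrow> nat \<Rightarrow> real"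
  assumes nonneg: "nonneg_mat (mat 5 5 (\<lambda>(i, j). a i j))"
    and P: "char_poly (mat 5 5 (\<lambda>(i, j). a i j)) =
      monom 1 5 + monom k2 3 + monom k3 2 + monom k4 1 + monom k5 0"
  shows "\<And>i j. i < 5 \<Longrightarrow> j < 5 \<Longrightarrow> 0 \<le> a i j"
    and "\<And>i. i < 5 \<Longrightarrow> a i i = 0"
    and "k2 = - (\<Sum>e\<in>pairs5. two_cycle a e)"
    and "k3 = - (\<Sum>e\<in>pairs5. co_three_cycles a e)"
    and "k4 = (\<Sum>e\<in>pairs5. \<Sum>f\<in>pairs5. if disjoint_pairs e f then two_cycle a e * two_cycle a f else 0) / 2
      - four_cycles a"
    and "k5 = (\<Sum>e\<in>pairs5. two_cycle a e * co_three_cycles a e) - five_cycles a"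
proof -
  let ?A = "mat 5 5 (\<lambda>(i, j). a i j)"
  show nn: "0 \<le> a i j" if "i < 5" "j < 5" for i j
    using nonneg elements_matI[OF mat_carrier that, of _ "\<lambda>(i, j). a i j"] that
    by (simp add: nonneg_mat_def)
  have "?A \<in> carrier_mat (Suc 4) (Suc 4)" by (simp add: eval_nat_numeral)
  from coeff_char_poly_trace[OF this] have "(\<Sum>i<5. ?A $$ (i, i)) = 0"
    by (simp add: P)
  then have "(\<Sum>i<5. a i i) = 0" by simp
  moreover have "(\<Sum>i<5. a i i) = 0 \<longleftrightarrow> (\<forall>i\<in>{..<5}. a i i = 0)"
    using nn by (intro sum_nonneg_eq_0_iff) simp_all
  ultimately show diag: "a i i = 0" if "i < 5" for i
    using that by simp
  let ?s = "\<Sum>e\<in>pairs5. two_cycle a e" and ?c = "\<Sum>e\<in>pairs5. co_three_cycles a e"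
    and ?p = "(\<Sum>e\<in>pairs5. \<Sum>f\<in>pairs5. if disjoint_pairs e f then two_cycle a e * two_cycle a f else 0) / 2
      - four_cycles a"
    and ?q = "(\<Sum>e\<in>pairs5. two_cycle a e * co_three_cycles a e) - five_cycles a"
  have "poly (char_poly ?A) = poly (monom 1 5 + monom (- ?s) 3 + monom (- ?c) 2 + monom ?p 1 + monom ?q 0)"
    using poly_char_poly_mat5[of a, OF diag] by (intro ext) (simp only: poly_monom poly_add power_one_right
      power_0 mult_1 mult_1_right mult_minus_left diff_conv_add_uminus)
  then have "monom 1 5 + monom k2 3 + monom k3 2 + monom k4 1 + monom k5 0 =
      monom 1 5 + monom (- ?s) 3 + monom (- ?c) 2 + monom ?p 1 + monom ?q 0"
    by (simp only: P poly_eq_poly_eq_iff)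
  note eq = arg_cong[OF this, of "\<lambda>p. coeff p _", unfolded coeff_add coeff_monom]
  show "k2 = - ?s" using eq[of 3] by simp
  show "k3 = - ?c" using eq[of 2] by simp
  show "k4 = ?p" using eq[of 1] by simp
  show "k5 = ?q" using eq[of 0] by simp
qed

section \<open>Nonnegative matrices with zero diagonal and the Petersen graph\<close>

locale nonneg_hollow5 =
  fixes a :: "nat \<Rightarrow> nat \<Rightarrow> real"
  assumes a_nonneg: "i < 5 \<Longrightarrow> j < 5 \<Longrightarrow> 0 \<le> a i j"
    and a_diag: "i < 5 \<Longrightarrow> a i i = 0"
begin

text \<open>Triangle-freeness is a count: three pairwise disjoint pairs would occupy six of the five
  vertices.\<close>

sublocale kneser: weighted_triangle_free_graph pairs5 disjoint_pairs "two_cycle a"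
proof
  show "finite pairs5" by (simp add: pairs5_eq)
  show "disjoint_pairs f e" if "disjoint_pairs e f" for e f
    using that by (auto simp: disjoint_pairs_def)
  show "\<not> disjoint_pairs f g" if "e \<in> pairs5" "f \<in> pairs5" "g \<in> pairs5"
    "disjoint_pairs e f" "disjoint_pairs e g" for e f g
  proof
    assume "disjoint_pairs f g"
    let ?s = "\<lambda>e. {fst e, snd e}"
    have disj: "?s e \<inter> ?s f = {}" "(?s e \<union> ?s f) \<inter> ?s g = {}"
      using that(4,5) \<open>disjoint_pairs f g\<close> by (simp_all add: disjoint_pairs_def Int_Un_distrib2)
    have card: "card (?s h) = 2" "?s h \<subseteq> {..<5}" if "h \<in> pairs5" for h
      using that by (auto simp: pairs5_def)
    have "card (?s e \<union> ?s f \<union> ?s g) = card (?s e) + card (?s f) + card (?s g)"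
      using disj by (simp only: card_Un_disjoint finite.intros finite_UnI)
    moreover have "card (?s e \<union> ?s f \<union> ?s g) \<le> card {..<5::nat}"
      using card(2)[OF that(1)] card(2)[OF that(2)] card(2)[OF that(3)]
      by (intro card_mono Un_least finite_lessThan)
    moreover have "card (?s e) = 2" "card (?s f) = 2" "card (?s g) = 2"
      using that(1-3) by (simp_all only: card(1))
    ultimately show False by simp
  qed
  show "0 \<le> two_cycle a e" if "e \<in> pairs5" for e
    using that by (auto simp: two_cycle_def pairs5_def intro!: mult_nonneg_nonneg a_nonneg)
qed

lemma edge_sum_eq_sum:
  "kneser.edge_sum pairs5 pairs5 =
    (\<Sum>e\<in>pairs5. \<Sum>f\<in>pairs5. if disjoint_pairs e f then two_cycle a e * two_cycle a f else 0)"
  by (simp add: kneser.edge_sum_def)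

text \<open>One summand is compared with the whole sum. This and the two analogous bounds serve to
  make a cycle sum positive as soon as a single cycle is.\<close>

lemma three_cycle_le:
  assumes "f \<in> pairs5" and "{x, y, z} \<subseteq> {..<5} - {fst f, snd f}"
  shows "a x y * a y z * a z x / 3 \<le> co_three_cycles a f"
proof -
  let ?T = "{..<5} - {fst f, snd f}"
  have "a x y * a y z * a z x \<le> (\<Sum>z\<in>?T. a x y * a y z * a z x)"
    using assms by (intro member_le_sum[of z]) (auto intro!: mult_nonneg_nonneg a_nonneg)
  also have "\<dots> \<le> (\<Sum>y\<in>?T. \<Sum>z\<in>?T. a x y * a y z * a z x)"
    using assms by (intro member_le_sum[of y ?T "\<lambda>y. \<Sum>z\<in>?T. a x y * a y z * a z x"])
      (auto intro!: sum_nonneg mult_nonneg_nonneg a_nonneg)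
  also have "\<dots> \<le> (\<Sum>x\<in>?T. \<Sum>y\<in>?T. \<Sum>z\<in>?T. a x y * a y z * a z x)"
    using assms by (intro member_le_sum[of x ?T "\<lambda>x. \<Sum>y\<in>?T. \<Sum>z\<in>?T. a x y * a y z * a z x"])
      (auto intro!: sum_nonneg mult_nonneg_nonneg a_nonneg)
  finally show ?thesis by (simp add: co_three_cycles_def)
qed

lemma four_cycle_le:
  assumes "distinct [x, y, z, u]" and "{x, y, z, u} \<subseteq> {..<5}"
  shows "a x y * a y z * a z u * a u x / 4 \<le> four_cycles a"
proof -
  let ?V = "{..<5::nat}"
  let ?p = "\<lambda>x y z u. a x y * a y z * a z u * a u x"
  have "?p x y z u \<le> (\<Sum>u\<in>?V - {x, y, z}. ?p x y z u)"
    using assms by (intro member_le_sum[of u]) (auto intro!: mult_nonneg_nonneg a_nonneg)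
  also have "\<dots> \<le> (\<Sum>z\<in>?V - {x, y}. \<Sum>u\<in>?V - {x, y, z}. ?p x y z u)"
    using assms by (intro member_le_sum[of z _ "\<lambda>z. \<Sum>u\<in>?V - {x, y, z}. ?p x y z u"])
      (auto intro!: sum_nonneg mult_nonneg_nonneg a_nonneg)
  also have "\<dots> \<le> (\<Sum>y\<in>?V - {x}. \<Sum>z\<in>?V - {x, y}. \<Sum>u\<in>?V - {x, y, z}. ?p x y z u)"
    using assms by (intro member_le_sum[of y _ "\<lambda>y. \<Sum>z\<in>?V - {x, y}. \<Sum>u\<in>?V - {x, y, z}. ?p x y z u"])
      (auto intro!: sum_nonneg mult_nonneg_nonneg a_nonneg)
  also have "\<dots> \<le> (\<Sum>x<5. \<Sum>y\<in>?V - {x}. \<Sum>z\<in>?V - {x, y}. \<Sum>u\<in>?V - {x, y, z}. ?p x y z u)"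
    using assms
    by (intro member_le_sum[of x _ "\<lambda>x. \<Sum>y\<in>?V - {x}. \<Sum>z\<in>?V - {x, y}. \<Sum>u\<in>?V - {x, y, z}. ?p x y z u"])
      (auto intro!: sum_nonneg mult_nonneg_nonneg a_nonneg)
  finally show ?thesis by (simp add: four_cycles_def)
qed

lemma five_cycle_le:
  assumes "distinct [x, y, z, u, v]" and "{x, y, z, u, v} \<subseteq> {..<5}"
  shows "a x y * a y z * a z u * a u v * a v x / 5 \<le> five_cycles a"
proof -
  let ?V = "{..<5::nat}"
  let ?p = "\<lambda>x y z u v. a x y * a y z * a z u * a u v * a v x"
  let ?f = "\<lambda>x y z u. \<Sum>v\<in>?V - {x, y, z, u}. ?p x y z u v"
  have "?p x y z u v \<le> ?f x y z u"
    using assms by (intro member_le_sum[of v]) (auto intro!: mult_nonneg_nonneg a_nonneg)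
  also have "\<dots> \<le> (\<Sum>u\<in>?V - {x, y, z}. ?f x y z u)"
    using assms by (intro member_le_sum[of u _ "\<lambda>u. ?f x y z u"])
      (auto intro!: sum_nonneg mult_nonneg_nonneg a_nonneg)
  also have "\<dots> \<le> (\<Sum>z\<in>?V - {x, y}. \<Sum>u\<in>?V - {x, y, z}. ?f x y z u)"
    using assms by (intro member_le_sum[of z _ "\<lambda>z. \<Sum>u\<in>?V - {x, y, z}. ?f x y z u"])
      (auto intro!: sum_nonneg mult_nonneg_nonneg a_nonneg)
  also have "\<dots> \<le> (\<Sum>y\<in>?V - {x}. \<Sum>z\<in>?V - {x, y}. \<Sum>u\<in>?V - {x, y, z}. ?f x y z u)"
    using assms by (intro member_le_sum[of y _ "\<lambda>y. \<Sum>z\<in>?V - {x, y}. \<Sum>u\<in>?V - {x, y, z}. ?f x y z u"])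
      (auto intro!: sum_nonneg mult_nonneg_nonneg a_nonneg)
  also have "\<dots> \<le> (\<Sum>x<5. \<Sum>y\<in>?V - {x}. \<Sum>z\<in>?V - {x, y}. \<Sum>u\<in>?V - {x, y, z}. ?f x y z u)"
    using assms
    by (intro member_le_sum[of x _ "\<lambda>x. \<Sum>y\<in>?V - {x}. \<Sum>z\<in>?V - {x, y}. \<Sum>u\<in>?V - {x, y, z}. ?f x y z u"])
      (auto intro!: sum_nonneg mult_nonneg_nonneg a_nonneg)
  finally show ?thesis by (simp add: five_cycles_def)
qed

lemma co_three_cycles_nonneg: "0 \<le> co_three_cycles a e"
  unfolding co_three_cycles_def by (auto intro!: sum_nonneg mult_nonneg_nonneg a_nonneg)

lemma four_cycles_nonneg: "0 \<le> four_cycles a"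
  unfolding four_cycles_def by (auto intro!: sum_nonneg mult_nonneg_nonneg a_nonneg)

lemma five_cycles_nonneg: "0 \<le> five_cycles a"
  unfolding five_cycles_def by (auto intro!: sum_nonneg mult_nonneg_nonneg a_nonneg)

lemma ex_complement_pair:
  assumes "distinct [x, y, z]" and "{x, y, z} \<subseteq> {..<5}"
  shows "\<exists>f\<in>pairs5. {x, y, z} \<subseteq> {..<5} - {fst f, snd f}"
proof -
  have "card ({..<5} - {x, y, z}) = 2"
    using assms by (subst card_Diff_subset) auto
  then obtain p q where pq: "{..<5} - {x, y, z} = {p, q}" "p \<noteq> q"
    unfolding card_2_iff by blast
  have "p \<in> {..<5} - {x, y, z}" "q \<in> {..<5} - {x, y, z}" unfolding pq(1) by simp_all
  then have pq': "p < 5" "q < 5" "p \<notin> {x, y, z}" "q \<notin> {x, y, z}" by simp_all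
  define f where "f = (min p q, max p q)"
  have "{fst f, snd f} = {p, q}" by (auto simp: f_def min_def max_def)
  then have "{x, y, z} \<subseteq> {..<5} - {fst f, snd f}" using pq' assms(2) by simp
  moreover have "f \<in> pairs5" using pq' pq(2) by (simp add: f_def pairs5_def)
  ultimately show ?thesis by blast
qed

text \<open>An arc of a strongly connected digraph lies on a simple cycle, here of length at most 5.\<close>

lemma arc_cases:
  assumes irred: "irreducible_mat (mat 5 5 (\<lambda>(i, j). a i j))"
    and four: "four_cycles a = 0" and five: "five_cycles a = 0"
    and arc: "i < 5" "j < 5" "a i j \<noteq> 0"
  shows "0 < two_cycle a (min i j, max i j) \<or>
    (\<exists>f\<in>pairs5. {i, j} \<inter> {fst f, snd f} = {} \<and> 0 < co_three_cycles a f)"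
proof -
  let ?A = "mat 5 5 (\<lambda>(i, j). a i j)"
  let ?R = "{(i, j). i < 5 \<and> j < 5 \<and> ?A $$ (i, j) \<noteq> 0}"
  have "i \<noteq> j" using arc a_diag by auto
  have "(j, i) \<in> ?R\<^sup>*"
    \<comment> \<open>A path from \<open>j\<close> back to \<open>i\<close> closes the arc to a
      cycle.\<close>
    by (rule irreducible_mat_reachable[OF _ irred arc(1,2)]) simp
  from rtrancl_imp_distinct_path[OF this] obtain xs where xs: "distinct (j # xs)" "last (j # xs) = i"
    "successively (\<lambda>x y. (x, y) \<in> ?R) (j # xs)"
    by (elim exE conjE)
  have "xs \<noteq> []" using xs(2) \<open>i \<noteq> j\<close> by auto
  have pos: "0 < a x y" if "(x, y) \<in> ?R" for x y
    using that a_nonneg[of x y] by auto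
  have "0 < a i j" using arc a_nonneg[of i j] by simp
  have sub: "set (j # xs) \<subseteq> {..<5}"
  proof -
    have "set ys \<subseteq> {..<5}" if "successively (\<lambda>x y. (x, y) \<in> ?R) (y # ys)" for y ys
      using that by (induction ys arbitrary: y) auto
    from this[OF xs(3)] show ?thesis using arc(2) by simp
  qed
  from card_mono[OF _ sub] have "length xs \<le> 4"
    using distinct_card[OF xs(1)] by simp
  \<comment> \<open>Together with the arc, a list \<open>xs\<close> of length \<open>k\<close> gives
    a cycle of length \<open>k + 1\<close>.\<close>
  then consider "xs = [i]" | y where "xs = [y, i]" | y z where "xs = [y, z, i]"
    | y z u where "xs = [y, z, u, i]"
    using xs(2) \<open>xs \<noteq> []\<close> by (auto simp: le_Suc_eq numeral_eq_Suc length_Suc_conv)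
  then show ?thesis
  proof cases
    case 1
    then have "0 < a j i" using xs(3) pos by simp
    then show ?thesis using \<open>0 < a i j\<close> by (auto simp: two_cycle_def min_def max_def)
  next
    case 2
    have "\<exists>f\<in>pairs5. {i, j, y} \<subseteq> {..<5} - {fst f, snd f}"
      by (rule ex_complement_pair) (use xs(1) sub 2 in auto)
    then obtain f where f: "f \<in> pairs5" "{i, j, y} \<subseteq> {..<5} - {fst f, snd f}" ..
    have "0 < a i j * a j y * a y i / 3" using 2 xs(3) \<open>0 < a i j\<close>
      by (auto intro!: divide_pos_pos mult_pos_pos pos)
    also have "\<dots> \<le> co_three_cycles a f" using f by (rule three_cycle_le)
    finally have "0 < co_three_cycles a f" .
    moreover have "{i, j} \<inter> {fst f, snd f} = {}" using f(2) by simp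
    ultimately show ?thesis using f(1) by blast
  next
    case 3
    then have "0 < a i j * a j y * a y z * a z i / 4" using xs(3) \<open>0 < a i j\<close>
      by (auto intro!: divide_pos_pos mult_pos_pos pos)
    also have "\<dots> \<le> four_cycles a"
      by (rule four_cycle_le) (use xs(1) sub 3 in auto)
    finally show ?thesis using four by simp
  next
    case 4
    then have "0 < a i j * a j y * a y z * a z u * a u i / 5" using xs(3) \<open>0 < a i j\<close>
      by (auto intro!: divide_pos_pos mult_pos_pos pos)
    also have "\<dots> \<le> five_cycles a"
      by (rule five_cycle_le) (use xs(1) sub 4 in auto)
    finally show ?thesis using five by simp
  qed
qed

end

subsection \<open>Bounds on the coefficients and their equality cases\<close>

lemma sum_pos_imp_ex_pos:
  fixes f :: "'b \<Rightarrow> real"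
  assumes "0 < sum f M"
  shows "\<exists>x\<in>M. 0 < f x"
proof (rule ccontr)
  assume "\<not> (\<exists>x\<in>M. 0 < f x)"
  then have "sum f M \<le> 0" by (intro sum_nonpos) (auto simp: not_less)
  with assms show False by simp
qed

context nonneg_hollow5
begin

text \<open>For the characteristic polynomial the four quantities are \<open>- k2\<close>,
  \<open>- k3\<close>, \<open>k4\<close> and \<open>k5\<close>.\<close>

abbreviation two_cycles where "two_cycles \<equiv> \<Sum>e\<in>pairs5. two_cycle a e"
abbreviation three_cycles where "three_cycles \<equiv> \<Sum>e\<in>pairs5. co_three_cycles a e"
abbreviation coeff1 where "coeff1 \<equiv> kneser.edge_sum pairs5 pairs5 / 2 - four_cycles a"
abbreviation coeff0 where "coeff0 \<equiv> (\<Sum>e\<in>pairs5. two_cycle a e * co_three_cycles a e) - five_cycles a"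

lemma two_cycles_nonneg: "0 \<le> two_cycles"
  by (intro sum_nonneg kneser.w_nonneg)

lemma three_cycles_nonneg: "0 \<le> three_cycles"
  by (intro sum_nonneg co_three_cycles_nonneg)

lemma coeff1_le: "4 * coeff1 \<le> two_cycles\<^sup>2"
  using kneser.edge_sum_le four_cycles_nonneg by simp

lemma two_cycle_le_two_cycles: "e \<in> pairs5 \<Longrightarrow> two_cycle a e \<le> two_cycles"
  by (intro member_le_sum kneser.w_nonneg kneser.finite_V) auto

text \<open>If a single weight \<open>m\<close> exceeds half the total \<open>s\<close>, the bound
  around a vertex gives \<open>coeff1 <= m * (s - m)\<close>, so \<open>m\<close> is at most the
  larger root of \<open>t^2 - s * t + coeff1\<close>.\<close>

lemma two_cycle_le_root:
  assumes e: "e \<in> pairs5"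
  shows "two_cycle a e \<le> two_cycles / 2 + sqrt (two_cycles\<^sup>2 / 4 - coeff1)"
proof (cases "two_cycle a e \<le> two_cycles / 2")
  case True
  have "0 \<le> sqrt (two_cycles\<^sup>2 / 4 - coeff1)" using coeff1_le by simp
  with True show ?thesis by linarith
next
  case False
  let ?m = "two_cycle a e" and ?R = "pairs5 - kneser.nbrs e - {e}"
  have "0 \<le> sum (two_cycle a) ?R * (2 * ?m - two_cycles)"
    using False by (intro mult_nonneg_nonneg sum_nonneg kneser.w_nonneg) auto
  with kneser.edge_sum_le_vertex[OF e refl] have "coeff1 \<le> ?m * (two_cycles - ?m)"
    using four_cycles_nonneg by simp
  then have "(?m - two_cycles / 2)\<^sup>2 \<le> two_cycles\<^sup>2 / 4 - coeff1"
    by (simp add: power2_eq_square algebra_simps)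
  then have "?m - two_cycles / 2 \<le> sqrt (two_cycles\<^sup>2 / 4 - coeff1)" by (rule real_le_rsqrt)
  then show ?thesis by simp
qed

lemma coeff0_le:
  assumes "\<And>e. e \<in> pairs5 \<Longrightarrow> two_cycle a e \<le> L"
  shows "coeff0 \<le> L * three_cycles"
proof -
  have "(\<Sum>e\<in>pairs5. two_cycle a e * co_three_cycles a e) \<le> (\<Sum>e\<in>pairs5. L * co_three_cycles a e)"
    using assms by (intro sum_mono mult_right_mono co_three_cycles_nonneg)
  then show ?thesis using five_cycles_nonneg by (simp add: sum_distrib_left)
qed

text \<open>Covers cases 1 and 2. Equality excludes 5-cycles and allows 3-cycles only on the
  complement of a pair of weight \<open>L\<close>. Since \<open>L\<close> exceeds half the total,
  there is one such pair \<open>e\<close>, and equality in the bound around \<open>e\<close>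
  excludes 4-cycles and all 2-cycles sharing exactly one vertex with \<open>e\<close>. No remaining
  cycle joins \<open>e\<close> to its complement.\<close>

lemma reducible_if_coeff0_maximal:
  defines "L \<equiv> two_cycles / 2 + sqrt (two_cycles\<^sup>2 / 4 - coeff1)"
  assumes "coeff1 < two_cycles\<^sup>2 / 4" and pos: "0 < three_cycles" and coeff0: "coeff0 = L * three_cycles"
  shows "\<not> irreducible_mat (mat 5 5 (\<lambda>(i, j). a i j))"
proof
  assume irred: "irreducible_mat (mat 5 5 (\<lambda>(i, j). a i j))"
  have L: "two_cycles < 2 * L" using assms(2) by (simp add: L_def)
  have slack_nonneg: "0 \<le> (L - two_cycle a e) * co_three_cycles a e" if "e \<in> pairs5" for e
    using two_cycle_le_root[OF that] co_three_cycles_nonneg by (intro mult_nonneg_nonneg) (auto simp: L_def)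
  have "(\<Sum>e\<in>pairs5. (L - two_cycle a e) * co_three_cycles a e) + five_cycles a = 0"
    using coeff0 by (simp add: left_diff_distrib sum_subtractf sum_distrib_left)
  moreover have "0 \<le> (\<Sum>e\<in>pairs5. (L - two_cycle a e) * co_three_cycles a e)"
    using slack_nonneg by (rule sum_nonneg)
  ultimately have five: "five_cycles a = 0"
    and "(\<Sum>e\<in>pairs5. (L - two_cycle a e) * co_three_cycles a e) = 0"
    using five_cycles_nonneg by linarith+
  then have tight: "two_cycle a e = L" if "e \<in> pairs5" "0 < co_three_cycles a e" for e
    using sum_nonneg_eq_0_iff[OF kneser.finite_V slack_nonneg] that by auto
  obtain e where e: "e \<in> pairs5" "0 < co_three_cycles a e"
    using sum_pos_imp_ex_pos[OF pos] by blast
  have m: "two_cycle a e = L" using tight[OF e] .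
  have only_e: "co_three_cycles a f = 0" if "f \<in> pairs5" "f \<noteq> e" for f
  proof (rule ccontr)
    assume "co_three_cycles a f \<noteq> 0"
    then have "two_cycle a f = L" using tight that co_three_cycles_nonneg[of f] by simp
    have "two_cycle a e + two_cycle a f = sum (two_cycle a) {e, f}" using that by simp
    also have "\<dots> \<le> two_cycles"
      using that e by (intro sum_mono2 kneser.w_nonneg kneser.finite_V) auto
    finally show False using L m \<open>two_cycle a f = L\<close> by simp
  qed
  let ?R = "pairs5 - kneser.nbrs e - {e}"
  \<comment> \<open>\<open>L\<close> is a root of \<open>t * (two_cycles - t) = coeff1\<close>, so
    the bound around \<open>e\<close> is attained.\<close>
  have "L * (two_cycles - L) = coeff1"
    using coeff1_le unfolding L_def by (simp add: algebra_simps power2_eq_square flip: power2_eq_square)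
      (simp add: power2_eq_square field_simps)
  then have "four_cycles a + sum (two_cycle a) ?R * (2 * L - two_cycles) \<le> 0"
    using kneser.edge_sum_le_vertex[OF e(1) refl] unfolding m by simp
  moreover have R_nonneg: "0 \<le> sum (two_cycle a) ?R"
    by (intro sum_nonneg kneser.w_nonneg) auto
  moreover from this have "0 \<le> sum (two_cycle a) ?R * (2 * L - two_cycles)" using L by simp
  ultimately have four: "four_cycles a = 0" and "sum (two_cycle a) ?R * (2 * L - two_cycles) = 0"
    using four_cycles_nonneg by linarith+
  then have "sum (two_cycle a) ?R = 0" using L by simp
  then have R: "two_cycle a f = 0" if "f \<in> ?R" for f
    using sum_nonneg_eq_0_iff[of ?R "two_cycle a"] kneser.finite_V kneser.w_nonneg that by simp
  let ?X = "{fst e, snd e}"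
  have e': "fst e < snd e" "snd e < 5" using e(1) by (auto simp: pairs5_def)
  have "?X \<noteq> {0..<5}"
  proof
    assume "?X = {0..<5}"
    then have "card ?X = 5" by simp
    then show False using card_insert_le_m1[of 2 "{snd e}" "fst e"] by simp
  qed
  moreover have "?X \<subseteq> {0..<5}" using e' by simp
  ultimately obtain i j where ij: "i \<in> ?X" "j \<in> {0..<5} - ?X" and "mat 5 5 (\<lambda>(i, j). a i j) $$ (i, j) \<noteq> 0"
    using irred[unfolded irreducible_mat_iff[OF mat_carrier], rule_format, of ?X] by blast
  moreover have "i < 5" "j < 5" using ij e' by auto
  ultimately have "a i j \<noteq> 0" by simp
  let ?f = "(min i j, max i j)"
  have "i \<noteq> j" using ij by auto
  have "0 < two_cycle a ?f \<or>
      (\<exists>f\<in>pairs5. {i, j} \<inter> {fst f, snd f} = {} \<and> 0 < co_three_cycles a f)"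
    by (rule arc_cases[OF irred four five \<open>i < 5\<close> \<open>j < 5\<close> \<open>a i j \<noteq> 0\<close>])
  then show False
  proof (elim disjE bexE conjE)
    assume "0 < two_cycle a ?f"
    moreover have "?f \<in> pairs5" using \<open>i < 5\<close> \<open>j < 5\<close> \<open>i \<noteq> j\<close> by (auto simp: pairs5_def)
    moreover have f_set: "{fst ?f, snd ?f} = {i, j}" by (auto simp: min_def max_def)
    then have "\<not> disjoint_pairs e ?f" unfolding disjoint_pairs_def f_set using ij(1) by blast
    moreover have "?f \<noteq> e" using f_set ij(2) by auto
    ultimately show False using R[of ?f] by (simp add: kneser.nbrs_def)
  next
    fix f assume f: "f \<in> pairs5" "{i, j} \<inter> {fst f, snd f} = {}" "0 < co_three_cycles a f"
    then have "f \<noteq> e" using ij(1) by auto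
    then show False using only_e f by simp
  qed
qed

text \<open>Covers case 3. Only 2-cycles survive, and the extremal case of the Mantel bound splits
  them into two nonempty families, every member of one being disjoint from every member of the
  other. No arc leaves the vertices covered by one family.\<close>

lemma reducible_if_coeff1_maximal:
  assumes "0 < two_cycles" and "three_cycles = 0" and coeff1: "4 * coeff1 = two_cycles\<^sup>2" and "coeff0 = 0"
  shows "\<not> irreducible_mat (mat 5 5 (\<lambda>(i, j). a i j))"
proof
  assume irred: "irreducible_mat (mat 5 5 (\<lambda>(i, j). a i j))"
  have no3: "co_three_cycles a f = 0" if "f \<in> pairs5" for f
    using \<open>three_cycles = 0\<close> sum_nonneg_eq_0_iff[OF kneser.finite_V co_three_cycles_nonneg] that by simp
  then have five: "five_cycles a = 0" using \<open>coeff0 = 0\<close> by simp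
  have four: "four_cycles a = 0" and extremal: "2 * kneser.edge_sum pairs5 pairs5 = two_cycles\<^sup>2"
    using coeff1 kneser.edge_sum_le four_cycles_nonneg by simp_all
  obtain N where N: "N \<subseteq> pairs5" "2 * sum (two_cycle a) N = two_cycles"
    and joined: "\<forall>g\<in>pairs5 - N. \<forall>h\<in>N. 0 < two_cycle a g \<longrightarrow> 0 < two_cycle a h \<longrightarrow> disjoint_pairs g h"
    using kneser.edge_sum_extremal[OF extremal] by (elim exE conjE)
  have "0 < sum (two_cycle a) N" using N(2) \<open>0 < two_cycles\<close> by simp
  then obtain h where h: "h \<in> N" "0 < two_cycle a h" using sum_pos_imp_ex_pos by blast
  have "sum (two_cycle a) (pairs5 - N) = two_cycles - sum (two_cycle a) N"
    by (rule sum_diff[OF kneser.finite_V N(1)])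
  then have "0 < sum (two_cycle a) (pairs5 - N)" using N(2) \<open>0 < two_cycles\<close> by simp
  then obtain g where g: "g \<in> pairs5 - N" "0 < two_cycle a g" using sum_pos_imp_ex_pos by blast
  \<comment> \<open>The vertices covered by the 2-cycles of positive weight in \<open>N\<close>; the
    pair \<open>g\<close> outside \<open>N\<close> shows that some vertex is missed.\<close>
  let ?X = "\<Union>h\<in>{h \<in> N. 0 < two_cycle a h}. {fst h, snd h}"
  have "fst h \<in> ?X" using h by blast
  moreover have "?X \<subseteq> {0..<5}" using N(1) by (auto simp: pairs5_def)
  moreover have "fst g \<notin> ?X"
    using joined[rule_format, OF g(1) _ g(2)] unfolding disjoint_pairs_def by blast
  moreover have "fst g \<in> {0..<5}" using g(1) by (auto simp: pairs5_def)
  ultimately obtain i j where ij: "i \<in> ?X" "j \<in> {0..<5} - ?X"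
    and "mat 5 5 (\<lambda>(i, j). a i j) $$ (i, j) \<noteq> 0"
    using irred[unfolded irreducible_mat_iff[OF mat_carrier], rule_format, of ?X] by blast
  moreover have "i < 5" "j < 5" using ij \<open>?X \<subseteq> {0..<5}\<close> by auto
  ultimately have "a i j \<noteq> 0" by simp
  let ?f = "(min i j, max i j)"
  have pos: "0 < two_cycle a ?f"
    using arc_cases[OF irred four five \<open>i < 5\<close> \<open>j < 5\<close> \<open>a i j \<noteq> 0\<close>] no3 by auto
  have "i \<noteq> j" using ij by auto
  then have f: "?f \<in> pairs5" using \<open>i < 5\<close> \<open>j < 5\<close> by (auto simp: pairs5_def)
  have f_set: "{fst ?f, snd ?f} = {i, j}" by (auto simp: min_def max_def)
  obtain h where h: "h \<in> N" "0 < two_cycle a h" "i \<in> {fst h, snd h}"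
    using ij(1) by blast
  show False
  proof (cases "?f \<in> N")
    case True
    then have "j \<in> ?X" using pos f_set by blast
    with ij(2) show False by blast
  next
    case False
    then have "disjoint_pairs ?f h" using joined f pos h by simp
    then show False unfolding disjoint_pairs_def f_set using h(3) by blast
  qed
qed

end

subsection \<open>Irreducible realizations\<close>

definition mat5 :: "real list list \<Rightarrow> real mat" where
  "mat5 rs = mat 5 5 (\<lambda>(i, j). rs ! i ! j)"

definition quintic :: "real \<Rightarrow> real \<Rightarrow> real \<Rightarrow> real \<Rightarrow> real poly" where
  "quintic k2 k3 k4 k5 = monom 1 5 + monom k2 3 + monom k3 2 + monom k4 1 + monom k5 0"

lemma degree_quintic: "degree (quintic k2 k3 k4 k5) = 5"
proof (rule antisym)
  show "degree (quintic k2 k3 k4 k5) \<le> 5"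
    unfolding quintic_def by (intro degree_add_le order.trans[OF degree_monom_le]) simp_all
  show "5 \<le> degree (quintic k2 k3 k4 k5)"
    by (rule le_degree) (simp add: quintic_def)
qed

lemma poly_quintic: "poly (quintic k2 k3 k4 k5) x = x ^ 5 + k2 * x ^ 3 + k3 * x\<^sup>2 + k4 * x + k5"
  by (simp add: quintic_def poly_monom)

text \<open>Reduces an explicit witness to a determinant that Laplace expansion evaluates, the signs
  of its entries and a closed walk through all vertices.\<close>

lemma irreducibly_realizable_mat5:
  assumes char_poly: "\<And>x. det (mat 5 5 (\<lambda>(i, j). (if i = j then x else 0) - rs ! i ! j)) =
      x ^ 5 + k2 * x ^ 3 + k3 * x\<^sup>2 + k4 * x + k5"
    and rs: "length rs = 5" "\<And>r. r \<in> set rs \<Longrightarrow> length r = 5 \<and> (\<forall>x\<in>set r. 0 \<le> x)"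
    and walk: "successively (\<lambda>i j. rs ! i ! j \<noteq> 0) ws" "last ws = hd ws" "set ws = {0..<5}"
  shows "irreducibly_realizable (quintic k2 k3 k4 k5)"
  unfolding irreducibly_realizable_def degree_quintic
proof (intro bexI conjI)
  show A: "mat5 rs \<in> carrier_mat 5 5" by (simp add: mat5_def)
  have "0 \<le> rs ! i ! j" if "i < 5" "j < 5" for i j
    using rs(2)[of "rs ! i"] rs(1) that by (simp add: all_set_conv_all_nth)
  then show "nonneg_mat (mat5 rs)"
    by (auto simp: nonneg_mat_def mat5_def)
  have "successively (\<lambda>i j. mat5 rs $$ (i, j) \<noteq> 0) ws"
    using walk(1,3) by (auto simp: mat5_def intro: successively_mono)
  then show "irreducible_mat (mat5 rs)"
    using walk(2,3) by (rule irreducible_mat_if_closed_walk[OF A])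
  have "poly (char_poly (mat5 rs)) = poly (quintic k2 k3 k4 k5)"
    by (rule ext) (simp only: mat5_def poly_char_poly_mat char_poly poly_quintic)
  then show "char_poly (mat5 rs) = quintic k2 k3 k4 k5"
    by (simp only: poly_eq_poly_eq_iff)
qed

lemma atLeastLessThan5: "{0..<5::nat} = {0, 1, 2, 3, 4}"
  by (auto simp: eval_nat_numeral atLeast0_lessThan_Suc)

text \<open>The only cycles of the digraph are 01, 34, 012, 0123 and 01234, with the weights
  \<open>a\<close>, \<open>b\<close>, \<open>c\<close>, \<open>d\<close> and \<open>f\<close>.\<close>

lemma irreducibly_realizable_companion:
  assumes "0 \<le> a" "0 \<le> b" "0 \<le> c" "0 \<le> d" "0 \<le> f" and "0 < f \<or> 0 < b \<and> 0 < d"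
  shows "irreducibly_realizable (quintic (- (a + b)) (- c) (a * b - d) (b * c - f))"
proof (rule irreducibly_realizable_mat5[where
      rs = "[[0, 1, 0, 0, 0], [a, 0, 1, 0, 0], [c, 0, 0, 1, 0], [d, 0, 0, 0, 1], [f, 0, 0, b, 0]]" and
      ws = "if 0 < f then [0, 1, 2, 3, 4, 0] else [0, 1, 2, 3, 4, 3, 0 :: nat]"])
  let ?rows = "[[0, 1, 0, 0, 0], [a, 0, 1, 0, 0], [c, 0, 0, 1, 0], [d, 0, 0, 0, 1], [f, 0, 0, b, 0]]"
  \<comment> \<open>For \<open>f = 0\<close> the arc from 4 to 0 is missing, and the walk returns
    over the arcs from 4 to 3 and from 3 to 0.\<close>
  let ?ws = "if 0 < f then [0, 1, 2, 3, 4, 0] else [0, 1, 2, 3, 4, 3, 0 :: nat]"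
  show "det (mat 5 5 (\<lambda>(i, j). (if i = j then x else 0) - ?rows ! i ! j)) =
      x ^ 5 + - (a + b) * x ^ 3 + - c * x\<^sup>2 + (a * b - d) * x + (b * c - f)" for x
    by (simp add: mat_5_Suc det_mat_Suc cong: sum_weak_cong)
      (simp add: algebra_simps power2_eq_square power3_eq_cube power_numeral_even power_numeral_odd)
  show "successively (\<lambda>i j. ?rows ! i ! j \<noteq> 0) ?ws" "last ?ws = hd ?ws" "set ?ws = {0..<5}"
    using assms by (auto simp: atLeastLessThan5)
qed (use assms in auto)

text \<open>Triangles 014 and 234 of weight \<open>c / 2\<close> share vertex 4, and the 2-cycles 01
  and 23 have weight \<open>m\<close>. Each triangle is disjoint from the 2-cycle on the other, so
  both pairs of maximal weight are used and the digraph stays connected.\<close>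

lemma irreducibly_realizable_bowtie:
  assumes "0 < m" "0 < c"
  shows "irreducibly_realizable (quintic (- (2 * m)) (- c) (m\<^sup>2) (m * c))"
proof (rule irreducibly_realizable_mat5[where
      rs = "[[0, 1, 0, 0, 0], [m, 0, 0, 0, 1], [0, 0, 0, 1, 0], [0, 0, m, 0, 1], [c / 2, 0, c / 2, 0, 0]]" and
      ws = "[0, 1, 4, 2, 3, 4, 0 :: nat]"])
  let ?rows = "[[0, 1, 0, 0, 0], [m, 0, 0, 0, 1], [0, 0, 0, 1, 0], [0, 0, m, 0, 1], [c / 2, 0, c / 2, 0, 0]]"
  let ?ws = "[0, 1, 4, 2, 3, 4, 0 :: nat]"
  show "det (mat 5 5 (\<lambda>(i, j). (if i = j then x else 0) - ?rows ! i ! j)) =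
      x ^ 5 + - (2 * m) * x ^ 3 + - c * x\<^sup>2 + m\<^sup>2 * x + m * c" for x
    by (simp add: mat_5_Suc det_mat_Suc cong: sum_weak_cong)
      (simp add: algebra_simps power2_eq_square power3_eq_cube power_numeral_even power_numeral_odd)
  show "successively (\<lambda>i j. ?rows ! i ! j \<noteq> 0) ?ws" "last ?ws = hd ?ws" "set ?ws = {0..<5}"
    using assms by (auto simp: atLeastLessThan5)
qed (use assms in auto)

text \<open>The digraph is a tree with arcs both ways: edges 01, 12, 23, 24 of weights
  \<open>p\<close>, \<open>q\<close>, \<open>p / 2\<close>, \<open>p / 2\<close>. Only 01 is
  disjoint from another edge, namely from 23 and 24.\<close>

lemma irreducibly_realizable_path:
  assumes "0 < p" "0 < q"
  shows "irreducibly_realizable (quintic (- (2 * p + q)) 0 (p\<^sup>2) 0)"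
proof (rule irreducibly_realizable_mat5[where
      rs = "[[0, 1, 0, 0, 0], [p, 0, 1, 0, 0], [0, q, 0, 1, 1], [0, 0, p / 2, 0, 0], [0, 0, p / 2, 0, 0]]" and
      ws = "[0, 1, 2, 3, 2, 4, 2, 1, 0 :: nat]"])
  let ?rows = "[[0, 1, 0, 0, 0], [p, 0, 1, 0, 0], [0, q, 0, 1, 1], [0, 0, p / 2, 0, 0], [0, 0, p / 2, 0, 0]]"
  let ?ws = "[0, 1, 2, 3, 2, 4, 2, 1, 0 :: nat]"
  show "det (mat 5 5 (\<lambda>(i, j). (if i = j then x else 0) - ?rows ! i ! j)) =
      x ^ 5 + - (2 * p + q) * x ^ 3 + 0 * x\<^sup>2 + p\<^sup>2 * x + 0" for x
    by (simp add: mat_5_Suc det_mat_Suc cong: sum_weak_cong)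
      (simp add: algebra_simps power2_eq_square power3_eq_cube power_numeral_even power_numeral_odd)
  show "successively (\<lambda>i j. ?rows ! i ! j \<noteq> 0) ?ws" "last ?ws = hd ?ws" "set ?ws = {0..<5}"
    using assms by (auto simp: atLeastLessThan5)
qed (use assms in auto)

text \<open>Three 3-cycles share the arc from 0 to 1, which spreads the weight over all vertices
  without creating other cycles.\<close>

lemma irreducibly_realizable_three_cycles:
  assumes "0 < c"
  shows "irreducibly_realizable (quintic 0 (- c) 0 0)"
proof (rule irreducibly_realizable_mat5[where
      rs = "[[0, 1, 0, 0, 0], [0, 0, 1, 1, 1], [c / 3, 0, 0, 0, 0], [c / 3, 0, 0, 0, 0], [c / 3, 0, 0, 0, 0]]" and
      ws = "[0, 1, 2, 0, 1, 3, 0, 1, 4, 0 :: nat]"])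
  let ?rows = "[[0, 1, 0, 0, 0], [0, 0, 1, 1, 1], [c / 3, 0, 0, 0, 0], [c / 3, 0, 0, 0, 0], [c / 3, 0, 0, 0, 0]]"
  let ?ws = "[0, 1, 2, 0, 1, 3, 0, 1, 4, 0 :: nat]"
  show "det (mat 5 5 (\<lambda>(i, j). (if i = j then x else 0) - ?rows ! i ! j)) =
      x ^ 5 + 0 * x ^ 3 + - c * x\<^sup>2 + 0 * x + 0" for x
    by (simp add: mat_5_Suc det_mat_Suc cong: sum_weak_cong)
      (simp add: algebra_simps power2_eq_square power3_eq_cube power_numeral_even power_numeral_odd)
  show "successively (\<lambda>i j. ?rows ! i ! j \<noteq> 0) ?ws" "last ?ws = hd ?ws" "set ?ws = {0..<5}"
    using assms by (auto simp: atLeastLessThan5)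
qed (use assms in auto)

text \<open>All 2-cycles pass through vertex 0, so no two are disjoint.\<close>

lemma irreducibly_realizable_star:
  assumes "0 < s"
  shows "irreducibly_realizable (quintic (- s) 0 0 0)"
proof (rule irreducibly_realizable_mat5[where
      rs = "[[0, 1, 1, 1, 1], [s / 4, 0, 0, 0, 0], [s / 4, 0, 0, 0, 0], [s / 4, 0, 0, 0, 0], [s / 4, 0, 0, 0, 0]]" and
      ws = "[0, 1, 0, 2, 0, 3, 0, 4, 0 :: nat]"])
  let ?rows = "[[0, 1, 1, 1, 1], [s / 4, 0, 0, 0, 0], [s / 4, 0, 0, 0, 0], [s / 4, 0, 0, 0, 0], [s / 4, 0, 0, 0, 0]]"
  let ?ws = "[0, 1, 0, 2, 0, 3, 0, 4, 0 :: nat]"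
  show "det (mat 5 5 (\<lambda>(i, j). (if i = j then x else 0) - ?rows ! i ! j)) =
      x ^ 5 + - s * x ^ 3 + 0 * x\<^sup>2 + 0 * x + 0" for x
    by (simp add: mat_5_Suc det_mat_Suc cong: sum_weak_cong)
      (simp add: algebra_simps power2_eq_square power3_eq_cube power_numeral_even power_numeral_odd)
  show "successively (\<lambda>i j. ?rows ! i ! j \<noteq> 0) ?ws" "last ?ws = hd ?ws" "set ?ws = {0..<5}"
    using assms by (auto simp: atLeastLessThan5)
qed (use assms in auto)

text \<open>Splitting the weight \<open>d\<close> between the 4-cycles 0123 and 0124 connects the
  fifth vertex without a 5-cycle.\<close>

lemma irreducibly_realizable_four_cycles:
  assumes "0 \<le> c" "0 < d"
  shows "irreducibly_realizable (quintic 0 (- c) (- d) 0)"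
proof (rule irreducibly_realizable_mat5[where
      rs = "[[0, 1, 0, 0, 0], [0, 0, 1, 0, 0], [c, 0, 0, 1, 1], [d / 2, 0, 0, 0, 0], [d / 2, 0, 0, 0, 0]]" and
      ws = "[0, 1, 2, 3, 0, 1, 2, 4, 0 :: nat]"])
  let ?rows = "[[0, 1, 0, 0, 0], [0, 0, 1, 0, 0], [c, 0, 0, 1, 1], [d / 2, 0, 0, 0, 0], [d / 2, 0, 0, 0, 0]]"
  let ?ws = "[0, 1, 2, 3, 0, 1, 2, 4, 0 :: nat]"
  show "det (mat 5 5 (\<lambda>(i, j). (if i = j then x else 0) - ?rows ! i ! j)) =
      x ^ 5 + 0 * x ^ 3 + - c * x\<^sup>2 + - d * x + 0" for x
    by (simp add: mat_5_Suc det_mat_Suc cong: sum_weak_cong)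
      (simp add: algebra_simps power2_eq_square power3_eq_cube power_numeral_even power_numeral_odd)
  show "successively (\<lambda>i j. ?rows ! i ! j \<noteq> 0) ?ws" "last ?ws = hd ?ws" "set ?ws = {0..<5}"
    using assms by (auto simp: atLeastLessThan5)
qed (use assms in auto)

text \<open>Below the bound for \<open>k5\<close>, the companion-like digraph works with a positive
  5-cycle. On the bound it works only if \<open>k2\<close> and \<open>k4\<close> are negative; the
  remaining boundary polynomials need the special digraphs.\<close>

lemma irreducibly_realizable_quintic:
  assumes k2: "k2 \<le> 0" and k3: "k3 \<le> 0" and k4: "4 * k4 \<le> k2\<^sup>2"
    and k5_nonpos: "k4 \<le> 0 \<Longrightarrow> k5 \<le> k2 * k3"
    and k5_pos: "0 < k4 \<Longrightarrow> k5 \<le> k3 * (k2 / 2 - sqrt (k2\<^sup>2 / 4 - k4))"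
    and nonzero: "\<not> (k2 = 0 \<and> k3 = 0 \<and> k4 = 0 \<and> k5 = 0)"
    and not1: "\<not> (k2 < 0 \<and> k3 < 0 \<and> k4 = 0 \<and> k5 = k2 * k3)"
    and not2: "\<not> (k2 < 0 \<and> k3 < 0 \<and> 0 < k4 \<and> k4 < k2\<^sup>2 / 4 \<and>
      k5 = k3 * (k2 / 2 - sqrt (k2\<^sup>2 / 4 - k4)))"
    and not3: "\<not> (k2 < 0 \<and> k3 = 0 \<and> k4 = k2\<^sup>2 / 4 \<and> k5 = 0)"
  shows "irreducibly_realizable (quintic k2 k3 k4 k5)"
proof (cases "0 < k4")
  case False
  then have k4': "k4 \<le> 0" by simp
  have "k5 \<le> k2 * k3" using k5_nonpos[OF k4'] .
  then have "(k5 < k2 * k3 \<or> k2 < 0 \<and> k4 < 0) \<or> (k5 = k2 * k3 \<and> k2 = 0 \<and> k4 < 0) \<or> (k5 = k2 * k3 \<and> k4 = 0)"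
    using k2 k4' by auto
  then consider "k5 < k2 * k3 \<or> k2 < 0 \<and> k4 < 0" | "k5 = k2 * k3" "k2 = 0" "k4 < 0"
    | "k5 = k2 * k3" "k4 = 0" by blast
  then show ?thesis
  proof cases
    case 1
    \<comment> \<open>The whole weight of the 2-cycles is put on 34, which is disjoint from the
      3-cycle 012.\<close>
    have "irreducibly_realizable (quintic (- (0 + - k2)) (- (- k3)) (0 * - k2 - - k4)
        (- k2 * - k3 - (k2 * k3 - k5)))"
    proof (rule irreducibly_realizable_companion)
      show "0 < k2 * k3 - k5 \<or> 0 < - k2 \<and> 0 < - k4" using 1 by linarith
    qed (use k2 k3 k4' \<open>k5 \<le> k2 * k3\<close> in linarith)+
    then show ?thesis by simp
  next
    case 2
    then show ?thesis using irreducibly_realizable_four_cycles[of "- k3" "- k4"] k3 by simp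
  next
    case 3
    then have "(k2 = 0 \<and> k3 < 0) \<or> (k3 = 0 \<and> k2 < 0)"
      using nonzero not1 k2 k3 by auto
    then consider "k2 = 0" "k3 < 0" | "k3 = 0" "k2 < 0" by blast
    then show ?thesis
    proof cases
      case 1
      with 3 show ?thesis using irreducibly_realizable_three_cycles[of "- k3"] by simp
    next
      case 2
      with 3 show ?thesis using irreducibly_realizable_star[of "- k2"] by simp
    qed
  qed
next
  case True
  \<comment> \<open>The numbers \<open>- k2 / 2 - r\<close> and \<open>- k2 / 2 + r\<close> have sum
    \<open>- k2\<close> and product \<open>k4\<close>: they serve as weights of two disjoint
    2-cycles, the larger one being disjoint from the 3-cycle.\<close>
  define r where "r = sqrt (k2\<^sup>2 / 4 - k4)"
  have "0 \<le> k2\<^sup>2 / 4 - k4" using k4 by linarith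
  then have r: "0 \<le> r" "r\<^sup>2 = k2\<^sup>2 / 4 - k4"
    unfolding r_def by (rule real_sqrt_ge_zero, rule real_sqrt_pow2)
  have sq: "(- k2 / 2)\<^sup>2 = k2\<^sup>2 / 4" by (simp add: power_divide)
  have "r\<^sup>2 < (- k2 / 2)\<^sup>2" unfolding sq r(2) using True by linarith
  then have r_less: "r < - k2 / 2" by (rule power2_less_imp_less) (use k2 in linarith)
  have bound: "k5 \<le> k3 * (k2 / 2 - r)" using k5_pos[OF True] by (simp add: r_def)
  show ?thesis
  proof (cases "k5 < k3 * (k2 / 2 - r)")
    case True
    have "irreducibly_realizable (quintic (- ((- k2 / 2 - r) + (- k2 / 2 + r))) (- (- k3))
        ((- k2 / 2 - r) * (- k2 / 2 + r) - 0)
        ((- k2 / 2 + r) * (- k3) - (k3 * (k2 / 2 - r) - k5)))"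
      by (intro irreducibly_realizable_companion disjI1) (use r(1) r_less k3 True in linarith)+
    moreover have "(- k2 / 2 - r) * (- k2 / 2 + r) - 0 = k4"
      using r(2) by (simp add: power2_eq_square algebra_simps)
    moreover have "- ((- k2 / 2 - r) + (- k2 / 2 + r)) = k2" by linarith
    moreover have "(- k2 / 2 + r) * (- k3) - (k3 * (k2 / 2 - r) - k5) = k5"
      by (simp add: algebra_simps)
    ultimately show ?thesis by (simp only: minus_minus)
  next
    case False
    then have k5: "k5 = k3 * (k2 / 2 - r)" using bound by simp
    have "k2 < 0" using r_less r(1) by simp
    show ?thesis
    proof (cases "k4 = k2\<^sup>2 / 4")
      case True
      then have "r\<^sup>2 = 0" using r(2) by linarith
      then have "r = 0" by simp
      have "k3 \<noteq> 0"
      proof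
        assume "k3 = 0"
        with k5 have "k5 = 0" by simp
        with \<open>k2 < 0\<close> \<open>k3 = 0\<close> True have "k2 < 0 \<and> k3 = 0 \<and> k4 = k2\<^sup>2 / 4 \<and> k5 = 0"
          by (intro conjI)
        with not3 show False by contradiction
      qed
      then have "k3 < 0" using k3 by simp
      then have "irreducibly_realizable (quintic (- (2 * (- k2 / 2))) (- (- k3)) ((- k2 / 2)\<^sup>2)
          (- k2 / 2 * - k3))"
        using \<open>k2 < 0\<close> by (intro irreducibly_realizable_bowtie) linarith+
      moreover have "(- k2 / 2)\<^sup>2 = k4" using True sq by linarith
      moreover have "- (2 * (- k2 / 2)) = k2" by simp
      moreover have "- k2 / 2 * - k3 = k5" using k5 \<open>r = 0\<close> by simp
      ultimately show ?thesis by (simp only: minus_minus)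
    next
      case False
      then have "k4 < k2\<^sup>2 / 4" using k4 by simp
      have "\<not> k3 < 0"
      proof
        assume "k3 < 0"
        with \<open>k2 < 0\<close> \<open>0 < k4\<close> \<open>k4 < k2\<^sup>2 / 4\<close> k5[unfolded r_def]
        have "k2 < 0 \<and> k3 < 0 \<and> 0 < k4 \<and> k4 < k2\<^sup>2 / 4 \<and>
            k5 = k3 * (k2 / 2 - sqrt (k2\<^sup>2 / 4 - k4))"
          by (intro conjI)
        with not2 show False by contradiction
      qed
      then have "k3 = 0" using k3 by simp
      \<comment> \<open>This makes the weight \<open>q = - k2 - 2 * sqrt k4\<close> of the middle
        edge positive.\<close>
      have "sqrt k4 < - k2 / 2"
        by (rule real_less_lsqrt) (use \<open>k2 < 0\<close> \<open>k4 < k2\<^sup>2 / 4\<close> sq in linarith)+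
      then have "irreducibly_realizable (quintic (- (2 * sqrt k4 + (- k2 - 2 * sqrt k4))) 0 ((sqrt k4)\<^sup>2) 0)"
        by (intro irreducibly_realizable_path real_sqrt_gt_zero \<open>0 < k4\<close>) (use \<open>sqrt k4 < - k2 / 2\<close> in linarith)
      moreover have "- (2 * sqrt k4 + (- k2 - 2 * sqrt k4)) = k2" by linarith
      moreover have "(sqrt k4)\<^sup>2 = k4" using \<open>0 < k4\<close> by (intro real_sqrt_pow2) linarith
      moreover have "k5 = 0" unfolding k5 \<open>k3 = 0\<close> by (rule mult_zero_left)
      ultimately show ?thesis by (simp only: \<open>k3 = 0\<close>)
    qed
  qed
qed

section \<open>Realizability against irreducible realizability\<close>

theorem theorem26:
  fixes k2 k3 k4 k5 :: real and P :: "real poly" and case1 case2 case3 :: bool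
  assumes P: "P = monom 1 5 + monom k2 3 + monom k3 2 + monom k4 1 + monom k5 0"
    and "P \<noteq> monom 1 5"
  defines "case1 \<equiv> k2 < 0 \<and> k3 < 0 \<and> k4 = 0 \<and> k5 = k2 * k3"
    and "case2 \<equiv> k2 < 0 \<and> k3 < 0 \<and> 0 < k4 \<and> k4 < k2\<^sup>2 / 4 \<and>
                  k5 = k3 * (k2 / 2 - sqrt (k2\<^sup>2 / 4 - k4))"
    and "case3 \<equiv> k2 < 0 \<and> k3 = 0 \<and> k4 = k2\<^sup>2 / 4 \<and> k5 = 0"
  shows "(\<not> case1 \<and> \<not> case2 \<and> \<not> case3 \<longrightarrow> (realizable P \<longleftrightarrow> irreducibly_realizable P)) \<and>
         (case1 \<or> case2 \<or> case3 \<longrightarrow> \<not> irreducibly_realizable P)"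
proof -
  have P': "P = quintic k2 k3 k4 k5" by (simp add: P quintic_def)
  have deg: "degree P = 5" by (simp add: P' degree_quintic)
  show ?thesis
  proof (intro conjI impI iffI)
    assume not_cases: "\<not> case1 \<and> \<not> case2 \<and> \<not> case3" and "realizable P"
    then obtain A where A: "A \<in> carrier_mat 5 5" "nonneg_mat A" "char_poly A = P"
      unfolding realizable_def deg by blast
    define a where "a = (\<lambda>i j. A $$ (i, j))"
    have A_eq: "A = mat 5 5 (\<lambda>(i, j). a i j)"
      using A(1) by (intro eq_matI) (auto simp: a_def)
    note coeffs = coeffs_char_poly5[OF A(2,3)[unfolded A_eq P]]
    interpret nonneg_hollow5 a by standard (rule coeffs(1,2); assumption)+
    have k4: "k4 = coeff1" unfolding edge_sum_eq_sum by (rule coeffs(5))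
    note k2 = coeffs(3) and k3 = coeffs(4) and k5 = coeffs(6)
    have L: "k5 \<le> (- k2 / 2 + sqrt (k2\<^sup>2 / 4 - k4)) * - k3"
      using coeff0_le[OF two_cycle_le_root] unfolding k2 k3 k4 k5 by simp
    show "irreducibly_realizable P"
      unfolding P'
    proof (rule irreducibly_realizable_quintic)
      show "k2 \<le> 0" "k3 \<le> 0" using two_cycles_nonneg three_cycles_nonneg by (simp_all add: k2 k3)
      show "4 * k4 \<le> k2\<^sup>2" using coeff1_le unfolding k2 k4 by simp
      show "k5 \<le> k2 * k3" using coeff0_le[OF two_cycle_le_two_cycles] unfolding k2 k3 k5 by simp
      show "k5 \<le> k3 * (k2 / 2 - sqrt (k2\<^sup>2 / 4 - k4))" using L by (simp add: algebra_simps)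
      show "\<not> (k2 = 0 \<and> k3 = 0 \<and> k4 = 0 \<and> k5 = 0)" using assms(2) by (auto simp: P)
    qed (use not_cases in \<open>simp_all only: case1_def case2_def case3_def not_False_eq_True\<close>)
  next
    assume "irreducibly_realizable P"
    then show "realizable P" unfolding irreducibly_realizable_def realizable_def by blast
  next
    assume cases: "case1 \<or> case2 \<or> case3"
    show "\<not> irreducibly_realizable P"
    proof
      assume "irreducibly_realizable P"
      then obtain A where A: "A \<in> carrier_mat 5 5" "nonneg_mat A" "char_poly A = P"
        and irred: "irreducible_mat A"
        unfolding irreducibly_realizable_def deg by blast
      define a where "a = (\<lambda>i j. A $$ (i, j))"
      have A_eq: "A = mat 5 5 (\<lambda>(i, j). a i j)"
        using A(1) by (intro eq_matI) (auto simp: a_def)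
      note coeffs = coeffs_char_poly5[OF A(2,3)[unfolded A_eq P]]
      interpret nonneg_hollow5 a by standard (rule coeffs(1,2); assumption)+
      have k2: "two_cycles = - k2" and k3: "three_cycles = - k3"
        using coeffs(3,4) by simp_all
      have k4: "coeff1 = k4" unfolding edge_sum_eq_sum by (rule coeffs(5)[symmetric])
      note k5 = coeffs(6)[symmetric]
      note irred = irred[unfolded A_eq]
      from cases consider "k2 < 0" "k3 < 0" "k4 < k2\<^sup>2 / 4" "k5 = k3 * (k2 / 2 - sqrt (k2\<^sup>2 / 4 - k4))"
        | "k2 < 0" "k3 = 0" "k4 = k2\<^sup>2 / 4" "k5 = 0"
        unfolding case1_def case2_def case3_def
      proof (elim disjE conjE)
        \<comment> \<open>At \<open>k4 = 0\<close> the square root equals \<open>- k2 / 2\<close>,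
          so case 1 satisfies the formula of case 2 and the two are treated together.\<close>
        assume 1: "k2 < 0" "k3 < 0" "k4 = 0" "k5 = k2 * k3"
        then have "sqrt (k2\<^sup>2 / 4 - k4) = - k2 / 2"
          by (intro real_sqrt_unique) (simp_all add: power2_eq_square)
        with 1 that(1) show thesis by simp
      qed
      then show False
      proof cases
        case 1
        then have "k5 = (- k2 / 2 + sqrt (k2\<^sup>2 / 4 - k4)) * - k3" by (simp add: algebra_simps)
        then show False
          using reducible_if_coeff0_maximal[unfolded k2 k3 k4 k5] irred 1 by simp
      next
        case 2
        then show False
          using reducible_if_coeff1_maximal[unfolded k2 k3 k4 k5] irred by simp
      qed
    qed
  qed
qed

end
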